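(* Let $p$ be a prime number. Let $S$ be a nonempty totally disconnected compact Hausdorff topological space and $G$ an Abelian infinite second-countable totally disconnected compact Hausdorff topological group which is $p$-compatible and acts transitively and continuously on $S$ by homeomorphisms $x\mapsto xa$ ($x\in S$, $a\in G$). Let $\mathbf I$, $\mathbf J$ be the sets of operators on $C(S\times G,\mathbb C_p)$, and $\mathbf R(\mathbf I)$, $\mathbf R(\mathbf J)$ the algebras, defined in the context. Then: (i) $\mathbf R(\mathbf J)=\mathbf I'$ and $\mathbf R(\mathbf I)=\mathbf J'$; (ii) $\mathbf R(\mathbf J)=\mathbf R(\mathbf J)''$ and $\mathbf R(\mathbf I)=\mathbf R(\mathbf I)''$; (iii) if the action of $G$ on $S$ is free (i.e. $xa=x$ for some $x\in S$ implies $a=1$), then $\mathbf R(\mathbf I)$ and $\mathbf R(\mathbf J)$ are factors.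
   Context: $\mathbb C_p$ is the completion of an algebraic closure of $\mathbb Q_p$. $C(S\times G,\mathbb C_p)$ is the Banach space of continuous functions $S\times G\to\mathbb C_p$ with the supremum norm. $p$-compatibility: $G$ is $p$-compatible if there is no open subgroup $H\subset G$ such that $G/H$ has an element of order $p$. The group operation of $G$ is written multiplicatively. The action is a right action, $x(ab)=(xa)b$, $x1=x$, and the map $S\times G\to S$, $(x,a)\mapsto xa$ is continuous. For $a_0\in G$ and $\varphi\in C(S,\mathbb C_p)$ define bounded operators on $C(S\times G,\mathbb C_p)$: $$\overline U_{a_0}F(x,a)=F(xa_0,aa_0),\quad \overline V_{a_0}F(x,a)=F(x,a_0^{-1}a),$$ $$\overline L_\varphi F(x,a)=\varphi(x)F(x,a),\quad \overline M_\varphi F(x,a)=\varphi(xa^{-1})F(x,a).$$ $\mathbf I$ is the set of all operators $\overline U_{a_0}$ and $\overline L_\varphi$ ($a_0\in G$, $\varphi\in C(S,\mathbb C_p)$); $\mathbf J$ is the set of all operators $\overline V_{a_0}$ and $\overline M_\varphi$. $\mathbf R(\mathbf I)$ is the closure, in the strong operator topology on the algebra of bounded linear operators on $C(S\times G,\mathbb C_p)$, of the $\mathbb C_p$-algebra generated by $\mathbf I$ (the linear span of finite products of elements of $\mathbf I$); $\mathbf R(\mathbf J)$ is defined likewise from $\mathbf J$. For a set $\mathfrak X$ of bounded operators, the commutant $\mathfrak X'$ is the set of all bounded linear operators $B$ on the same space with $AB=BA$ for all $A\in\mathfrak X$; $\mathfrak X''=(\mathfrak X')'$. A factor is an algebra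 of operators whose center consists only of the scalar operators $\lambda I$, $\lambda\in\mathbb C_p$. *)

theory Defs
  imports
    "HOL-Analysis.Analysis"
    "HOL-Algebra.Multiplicative_Group"
    "HOL-Computational_Algebra.Computational_Algebra"
begin

section \<open>The field of complex p-adic numbers\<close>

text \<open>
  The library constant \<open>norm\<close> is confined to real normed spaces; hence the separate absolute value.
\<close>
class ultrametric_field = field_char_0 + metric_space +
  fixes vabs :: "'a \<Rightarrow> real"
  assumes dist_vabs: "dist x y = vabs (x - y)"
    and vabs_mult: "vabs (x * y) = vabs x * vabs y"
    and vabs_add: "vabs (x + y) \<le> max (vabs x) (vabs y)"

lemma vabs_eq_zero: "vabs x = 0 \<longleftrightarrow> x = (0::'k::ultrametric_field)"
  using dist_eq_0_iff[of x 0] by (simp add: dist_vabs)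

lemma vabs_zero [simp]: "vabs (0::'k::ultrametric_field) = 0"
  by (simp add: vabs_eq_zero)

lemma vabs_dist_zero: "dist x (0::'k::ultrametric_field) = vabs x"
  by (simp add: dist_vabs)

lemma vabs_ge_zero [simp]: "0 \<le> vabs (x::'k::ultrametric_field)"
  by (metis vabs_dist_zero zero_le_dist)

lemma vabs_one: "vabs (1::'k::ultrametric_field) = 1"
  by (metis mult_1 mult_cancel_right1 vabs_eq_zero vabs_mult zero_neq_one)

lemma vabs_minus: "vabs (- x::'k::ultrametric_field) = vabs x"
proof -
  have "dist 0 x = dist x 0" by (rule dist_commute)
  then show ?thesis by (simp add: dist_vabs)
qed

lemma vabs_triangle: "vabs (x + y::'k::ultrametric_field) \<le> vabs x + vabs y"
  using vabs_add[of x y] vabs_ge_zero[of x] vabs_ge_zero[of y] by linarith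

lemma ultra_tendsto_add:
  fixes f g :: "'b \<Rightarrow> 'k::ultrametric_field"
  assumes f: "(f \<longlongrightarrow> a) F" and g: "(g \<longlongrightarrow> b) F"
  shows "((\<lambda>x. f x + g x) \<longlongrightarrow> a + b) F"
proof -
  have lim: "((\<lambda>x. dist (f x) a + dist (g x) b) \<longlongrightarrow> 0) F"
    using tendsto_add[OF tendsto_dist_iff[THEN iffD1, OF f] tendsto_dist_iff[THEN iffD1, OF g]]
    by simp
  have le: "dist (f x + g x) (a + b) \<le> dist (f x) a + dist (g x) b" for x
    using vabs_triangle[of "f x - a" "g x - b"] by (simp add: dist_vabs algebra_simps)
  have "((\<lambda>x. dist (f x + g x) (a + b)) \<longlongrightarrow> 0) F"
    by (rule tendsto_sandwich[OF _ _ tendsto_const lim])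
      (intro always_eventually allI zero_le_dist le)+
  then show ?thesis by (rule tendsto_dist_iff[THEN iffD2])
qed

lemma ultra_tendsto_minus:
  fixes f :: "'b \<Rightarrow> 'k::ultrametric_field"
  assumes f: "(f \<longlongrightarrow> a) F"
  shows "((\<lambda>x. - f x) \<longlongrightarrow> - a) F"
proof -
  have "dist (- f x) (- a) = dist (f x) a" for x
    using vabs_minus[of "f x - a"] by (simp add: dist_vabs)
  then show ?thesis
    using tendsto_dist_iff[THEN iffD1, OF f] by (subst tendsto_dist_iff) simp
qed

lemma ultra_tendsto_mult:
  fixes f g :: "'b \<Rightarrow> 'k::ultrametric_field"
  assumes f: "(f \<longlongrightarrow> a) F" and g: "(g \<longlongrightarrow> b) F"
  shows "((\<lambda>x. f x * g x) \<longlongrightarrow> a * b) F"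
proof -
  let ?h = "\<lambda>x. dist (f x) a * dist (g x) b + vabs a * dist (g x) b + dist (f x) a * vabs b"
  note df = tendsto_dist_iff[THEN iffD1, OF f] and dg = tendsto_dist_iff[THEN iffD1, OF g]
  have "(?h \<longlongrightarrow> 0 * 0 + vabs a * 0 + 0 * vabs b) F"
    by (rule tendsto_add[OF tendsto_add[OF tendsto_mult[OF df dg] tendsto_mult[OF tendsto_const dg]]
          tendsto_mult[OF df tendsto_const]])
  then have lim: "(?h \<longlongrightarrow> 0) F" by (simp only: mult_zero_left mult_zero_right add_0)
  have le: "dist (f x * g x) (a * b) \<le> ?h x" for x
  proof -
    have eq: "f x * g x - a * b = (f x - a) * (g x - b) + a * (g x - b) + (f x - a) * b"
      by (simp add: algebra_simps)
    show ?thesis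
      using vabs_triangle[of "(f x - a) * (g x - b) + a * (g x - b)" "(f x - a) * b"]
        vabs_triangle[of "(f x - a) * (g x - b)" "a * (g x - b)"]
      unfolding dist_vabs eq vabs_mult by linarith
  qed
  have "((\<lambda>x. dist (f x * g x) (a * b)) \<longlongrightarrow> 0) F"
    by (rule tendsto_sandwich[OF _ _ tendsto_const lim])
      (intro always_eventually allI zero_le_dist le)+
  then show ?thesis by (rule tendsto_dist_iff[THEN iffD2])
qed

instance ultrametric_field \<subseteq> topological_ab_group_add
proof
  fix a b :: 'a
  show "LIM x (nhds a \<times>\<^sub>F nhds b). fst x + snd x :> nhds (a + b)"
    by (rule ultra_tendsto_add[OF filterlim_fst filterlim_snd])
  show "(uminus \<longlongrightarrow> - a) (nhds a)"
    by (rule ultra_tendsto_minus[OF filterlim_ident])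
qed

instance ultrametric_field \<subseteq> topological_monoid_mult
proof
  fix a b :: 'a
  show "LIM x (nhds a \<times>\<^sub>F nhds b). fst x * snd x :> nhds (a * b)"
    by (rule ultra_tendsto_mult[OF filterlim_fst filterlim_snd])
qed

definition padic_abs :: "nat \<Rightarrow> rat \<Rightarrow> real" where
  "padic_abs p r =
     (if r = 0 then 0
      else real p powi (int (multiplicity (int p) (snd (quotient_of r)))
                      - int (multiplicity (int p) (fst (quotient_of r)))))"

text \<open>
  In a complete field whose absolute value extends the p-adic absolute value of the rationals, the
  closure of the rationals is the field of p-adic numbers, i.e. the completion of the rationals.
\<close>
definition padic_numbers :: "'k::ultrametric_field set" where
  "padic_numbers = closure (range of_rat)"

definition algebraic_over :: "'k::field set \<Rightarrow> 'k \<Rightarrow> bool" where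
  "algebraic_over A z \<longleftrightarrow> (\<exists>P. P \<noteq> 0 \<and> (\<forall>i. Polynomial.coeff P i \<in> A) \<and> poly P z = 0)"

definition algebraically_closed :: "'k::field set \<Rightarrow> bool" where
  "algebraically_closed A \<longleftrightarrow>
     (\<forall>P. degree P > 0 \<and> (\<forall>i. Polynomial.coeff P i \<in> A) \<longrightarrow> (\<exists>z\<in>A. poly P z = 0))"

definition padic_algebraic_numbers :: "'k::ultrametric_field set" where
  "padic_algebraic_numbers = {z. algebraic_over padic_numbers z}"

text \<open>
  \<open>is_Cp p TYPE('k)\<close>: the complete valued field \<open>'k\<close> is a completion of an algebraic closure of
  the field of p-adic numbers. This determines \<open>'k\<close> up to isometric isomorphism. Algebraic
  closedness is required of the set of algebraic elements only, not of \<open>'k\<close> itself.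
\<close>
definition is_Cp :: "nat \<Rightarrow> 'k::{ultrametric_field, complete_space} itself \<Rightarrow> bool" where
  "is_Cp p _ \<longleftrightarrow>
     (\<forall>r. vabs (of_rat r :: 'k) = padic_abs p r) \<and>
     algebraically_closed (padic_algebraic_numbers :: 'k set) \<and>
     closure (padic_algebraic_numbers :: 'k set) = UNIV"


section \<open>Spaces and groups\<close>

definition totally_disconnected :: "'a::topological_space itself \<Rightarrow> bool" where
  "totally_disconnected _ \<longleftrightarrow> (\<forall>x::'a. connected_component_set UNIV x = {x})"

locale topological_comm_group = comm_group G
  for G :: "'g::topological_space monoid" (structure) +
  assumes carrier_UNIV: "carrier G = UNIV"
    and continuous_mult: "continuous_on UNIV (\<lambda>(a, b). a \<otimes> b)"
    and continuous_inv: "continuous_on UNIV (\<lambda>a. inv a)"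

locale continuous_right_action = topological_comm_group G
  for G :: "'g::topological_space monoid" (structure) +
  fixes act :: "'s::topological_space \<Rightarrow> 'g \<Rightarrow> 's"
  assumes act_one: "act x \<one> = x"
    and act_mult: "act x (a \<otimes> b) = act (act x a) b"
    and continuous_act: "continuous_on UNIV (\<lambda>(x, a). act x a)"

definition transitive_action :: "('s \<Rightarrow> 'g \<Rightarrow> 's) \<Rightarrow> bool" where
  "transitive_action act \<longleftrightarrow> (\<forall>x y. \<exists>a. act x a = y)"

definition free_action :: "('g, 'm) monoid_scheme \<Rightarrow> ('s \<Rightarrow> 'g \<Rightarrow> 's) \<Rightarrow> bool" where
  "free_action G act \<longleftrightarrow> (\<forall>a. (\<exists>x. act x a = x) \<longrightarrow> a = \<one>\<^bsub>G\<^esub>)"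

text \<open>
  Meant for commutative \<open>G\<close>, where every subgroup is normal and \<open>G Mod H\<close> is a group.
\<close>
definition p_compatible :: "nat \<Rightarrow> 'g::topological_space monoid \<Rightarrow> bool" where
  "p_compatible p G \<longleftrightarrow>
     \<not> (\<exists>H. subgroup H G \<and> open H \<and> (\<exists>X \<in> carrier (G Mod H). group.ord (G Mod H) X = p))"


section \<open>Bounded operators on spaces of continuous functions\<close>

text \<open>
  On a compact space, \<open>'x \<Rightarrow>\<^sub>C 'k\<close> is the space of all continuous functions with the supremum
  metric. The vector space structure supplied by the library needs a real normed space
  as range, hence the explicit operations below.
\<close>

lemma bcontfun_ultraI:
  fixes f :: "'x::topological_space \<Rightarrow> 'k::ultrametric_field"
  assumes "continuous_on UNIV f" and "\<And>x. vabs (f x) \<le> C"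
  shows "f \<in> bcontfun"
proof -
  have "dist 0 (f x) \<le> C" for x
    using assms(2)[of x] by (simp add: dist_commute[of 0 "f x"] vabs_dist_zero)
  then show ?thesis
    using assms(1) unfolding bcontfun_def bounded_def by blast
qed

lemma bcontfun_ultraE:
  fixes f :: "'x::topological_space \<Rightarrow> 'k::ultrametric_field"
  assumes "f \<in> bcontfun"
  obtains C where "C \<ge> 0" and "\<And>x. vabs (f x) \<le> C"
proof -
  from assms obtain e where e: "\<And>x. dist (f x) 0 \<le> e"
    unfolding bcontfun_def bounded_any_center[of _ 0] by (auto simp: dist_commute)
  then have "vabs (f x) \<le> e" for x by (metis vabs_dist_zero)
  then show thesis by (intro that[of "max e 0"]) (auto simp: le_max_iff_disj)
qed

lemma bcontfun_ultra_add:
  fixes f g :: "'x::topological_space \<Rightarrow> 'k::ultrametric_field"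
  assumes "f \<in> bcontfun" and "g \<in> bcontfun"
  shows "(\<lambda>x. f x + g x) \<in> bcontfun"
proof -
  obtain C where C: "C \<ge> 0" "\<And>x. vabs (f x) \<le> C" using bcontfun_ultraE[OF assms(1)] by blast
  obtain D where D: "D \<ge> 0" "\<And>x. vabs (g x) \<le> D" using bcontfun_ultraE[OF assms(2)] by blast
  have "vabs (f x + g x) \<le> C + D" for x
    using vabs_triangle[of "f x" "g x"] C(2)[of x] D(2)[of x] by linarith
  then show ?thesis
    using assms by (intro bcontfun_ultraI[of _ "C + D"] continuous_on_add) (auto simp: bcontfun_def)
qed

lemma bcontfun_ultra_mult:
  fixes f g :: "'x::topological_space \<Rightarrow> 'k::ultrametric_field"
  assumes "f \<in> bcontfun" and "g \<in> bcontfun"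
  shows "(\<lambda>x. f x * g x) \<in> bcontfun"
proof -
  obtain C where C: "C \<ge> 0" "\<And>x. vabs (f x) \<le> C" using bcontfun_ultraE[OF assms(1)] by blast
  obtain D where D: "D \<ge> 0" "\<And>x. vabs (g x) \<le> D" using bcontfun_ultraE[OF assms(2)] by blast
  have "vabs (f x * g x) \<le> C * D" for x
    unfolding vabs_mult using C D by (intro mult_mono) auto
  then show ?thesis
    using assms by (intro bcontfun_ultraI[of _ "C * D"] continuous_on_mult') (auto simp: bcontfun_def)
qed

definition cf_add ::
  "('x::topological_space \<Rightarrow>\<^sub>C 'k::ultrametric_field) \<Rightarrow> ('x \<Rightarrow>\<^sub>C 'k) \<Rightarrow> ('x \<Rightarrow>\<^sub>C 'k)" where
  "cf_add F H = Bcontfun (\<lambda>x. apply_bcontfun F x + apply_bcontfun H x)"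

definition cf_scale ::
  "'k::ultrametric_field \<Rightarrow> ('x::topological_space \<Rightarrow>\<^sub>C 'k) \<Rightarrow> ('x \<Rightarrow>\<^sub>C 'k)" where
  "cf_scale c F = Bcontfun (\<lambda>x. c * apply_bcontfun F x)"

lemma apply_cf_add: "apply_bcontfun (cf_add F H) x = apply_bcontfun F x + apply_bcontfun H x"
  by (simp add: cf_add_def Bcontfun_inverse bcontfun_ultra_add apply_bcontfun)

lemma apply_cf_scale: "apply_bcontfun (cf_scale c F) x = c * apply_bcontfun F x"
  by (simp add: cf_scale_def Bcontfun_inverse bcontfun_ultra_mult const_bcontfun apply_bcontfun)

definition sup_norm :: "('x::topological_space \<Rightarrow>\<^sub>C 'k::ultrametric_field) \<Rightarrow> real" where
  "sup_norm F = (SUP x. vabs (apply_bcontfun F x))"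

type_synonym ('x, 'k) operator = "('x \<Rightarrow>\<^sub>C 'k) \<Rightarrow> ('x \<Rightarrow>\<^sub>C 'k)"

definition bounded_operator ::
  "('x::topological_space, 'k::ultrametric_field) operator \<Rightarrow> bool" where
  "bounded_operator T \<longleftrightarrow>
     (\<forall>F H. T (cf_add F H) = cf_add (T F) (T H)) \<and>
     (\<forall>c F. T (cf_scale c F) = cf_scale c (T F)) \<and>
     (\<exists>C. \<forall>F. sup_norm (T F) \<le> C * sup_norm F)"

definition op_zero :: "('x::topological_space, 'k::ultrametric_field) operator" where
  "op_zero = (\<lambda>F. const_bcontfun 0)"

definition op_add :: "('x::topological_space, 'k::ultrametric_field) operator \<Rightarrow>
    ('x, 'k) operator \<Rightarrow> ('x, 'k) operator" where
  "op_add A B = (\<lambda>F. cf_add (A F) (B F))"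

definition op_scale :: "'k::ultrametric_field \<Rightarrow>
    ('x::topological_space, 'k) operator \<Rightarrow> ('x, 'k) operator" where
  "op_scale c A = (\<lambda>F. cf_scale c (A F))"

inductive_set op_span ::
  "('x::topological_space, 'k::ultrametric_field) operator set \<Rightarrow> ('x, 'k) operator set"
  for X where
  span_zero: "op_zero \<in> op_span X"
| span_step: "A \<in> X \<Longrightarrow> B \<in> op_span X \<Longrightarrow> op_add (op_scale c A) B \<in> op_span X"

definition op_products ::
  "('x::topological_space, 'k::ultrametric_field) operator set \<Rightarrow> ('x, 'k) operator set" where
  "op_products X = {foldr (\<circ>) As id | As. set As \<subseteq> X}"

text \<open>
  The library topology on a function type is that of pointwise convergence, here with respect
  to the supremum metric on the target.
\<close>
definition op_strong_topology ::
  "('x::topological_space, 'k::ultrametric_field) operator topology" where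
  "op_strong_topology = subtopology euclidean {T. bounded_operator T}"

definition generated_closed_algebra ::
  "('x::topological_space, 'k::ultrametric_field) operator set \<Rightarrow> ('x, 'k) operator set" where
  "generated_closed_algebra X = op_strong_topology closure_of (op_span (op_products X))"

definition commutant ::
  "('x::topological_space, 'k::ultrametric_field) operator set \<Rightarrow> ('x, 'k) operator set" where
  "commutant X = {B. bounded_operator B \<and> (\<forall>A\<in>X. A \<circ> B = B \<circ> A)}"

definition operator_algebra ::
  "('x::topological_space, 'k::ultrametric_field) operator set \<Rightarrow> bool" where
  "operator_algebra R \<longleftrightarrow>
     (\<forall>A\<in>R. bounded_operator A) \<and> op_zero \<in> R \<and>
     (\<forall>A\<in>R. \<forall>B\<in>R. op_add A B \<in> R \<and> A \<circ> B \<in> R) \<and>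
     (\<forall>c. \<forall>A\<in>R. op_scale c A \<in> R)"

definition op_center ::
  "('x::topological_space, 'k::ultrametric_field) operator set \<Rightarrow> ('x, 'k) operator set" where
  "op_center R = {B \<in> R. \<forall>A\<in>R. A \<circ> B = B \<circ> A}"

definition factor ::
  "('x::topological_space, 'k::ultrametric_field) operator set \<Rightarrow> bool" where
  "factor R \<longleftrightarrow> operator_algebra R \<and> op_center R = {op_scale c id | c. True}"


section \<open>The operators of the group measure space construction\<close>

text \<open>
  For a continuous action the functions below are bounded and continuous, so the abstraction
  \<open>Bcontfun\<close> is meaningful; see the evaluation lemmas at the end.
\<close>

definition opU :: "'g::topological_space monoid \<Rightarrow> ('s::topological_space \<Rightarrow> 'g \<Rightarrow> 's) \<Rightarrow>
    'g \<Rightarrow> ('s \<times> 'g, 'k::ultrametric_field) operator" where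
  "opU G act a0 F = Bcontfun (\<lambda>(x, a). apply_bcontfun F (act x a0, a \<otimes>\<^bsub>G\<^esub> a0))"

definition opV :: "'g::topological_space monoid \<Rightarrow>
    'g \<Rightarrow> ('s::topological_space \<times> 'g, 'k::ultrametric_field) operator" where
  "opV G a0 F = Bcontfun (\<lambda>(x, a). apply_bcontfun F (x, inv\<^bsub>G\<^esub> a0 \<otimes>\<^bsub>G\<^esub> a))"

definition opL :: "('s::topological_space \<Rightarrow>\<^sub>C 'k::ultrametric_field) \<Rightarrow>
    ('s \<times> 'g::topological_space, 'k) operator" where
  "opL \<phi> F = Bcontfun (\<lambda>(x, a). apply_bcontfun \<phi> x * apply_bcontfun F (x, a))"

definition opM :: "'g::topological_space monoid \<Rightarrow> ('s::topological_space \<Rightarrow> 'g \<Rightarrow> 's) \<Rightarrow>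
    ('s \<Rightarrow>\<^sub>C 'k::ultrametric_field) \<Rightarrow> ('s \<times> 'g, 'k) operator" where
  "opM G act \<phi> F =
     Bcontfun (\<lambda>(x, a). apply_bcontfun \<phi> (act x (inv\<^bsub>G\<^esub> a)) * apply_bcontfun F (x, a))"

definition setI :: "'g::topological_space monoid \<Rightarrow> ('s::topological_space \<Rightarrow> 'g \<Rightarrow> 's) \<Rightarrow>
    ('s \<times> 'g, 'k::ultrametric_field) operator set" where
  "setI G act = {opU G act a0 | a0. a0 \<in> carrier G} \<union> {opL \<phi> | \<phi>. True}"

definition setJ :: "'g::topological_space monoid \<Rightarrow> ('s::topological_space \<Rightarrow> 'g \<Rightarrow> 's) \<Rightarrow>
    ('s \<times> 'g, 'k::ultrametric_field) operator set" where
  "setJ G act = {opV G a0 | a0. a0 \<in> carrier G} \<union> {opM G act \<phi> | \<phi>. True}"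

lemma bcontfun_ultra_compose:
  fixes F :: "'y::topological_space \<Rightarrow>\<^sub>C 'k::ultrametric_field"
  assumes "continuous_on UNIV h"
  shows "(\<lambda>z. apply_bcontfun F (h z)) \<in> bcontfun"
proof -
  obtain C where C: "C \<ge> 0" "\<And>x. vabs (apply_bcontfun F x) \<le> C"
    using bcontfun_ultraE[OF apply_bcontfun[of F]] by blast
  then show ?thesis
    using continuous_on_compose2[OF continuous_on_apply_bcontfun[of UNIV F] assms]
    by (intro bcontfun_ultraI[of _ C] C(2)) auto
qed

lemma apply_opL:
  "apply_bcontfun (opL \<phi> F) (x, a) = apply_bcontfun \<phi> x * apply_bcontfun F (x, a)"
proof -
  have "(\<lambda>z. apply_bcontfun \<phi> (fst z) * apply_bcontfun F z) \<in> bcontfun"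
    by (intro bcontfun_ultra_mult bcontfun_ultra_compose continuous_intros apply_bcontfun)
  then show ?thesis
    by (simp add: opL_def case_prod_beta' Bcontfun_inverse)
qed

context continuous_right_action
begin

lemma apply_opU:
  "apply_bcontfun (opU G act a0 F) (x, a) = apply_bcontfun F (act x a0, a \<otimes> a0)"
proof -
  have "continuous_on UNIV (\<lambda>z::'s \<times> 'g. act (fst z) a0)"
    using continuous_on_compose2[OF continuous_act, of UNIV "\<lambda>z. (fst z, a0)"]
    by (simp add: case_prod_beta continuous_on_Pair continuous_on_fst continuous_on_snd)
  moreover have "continuous_on UNIV (\<lambda>z::'s \<times> 'g. snd z \<otimes> a0)"
    using continuous_on_compose2[OF continuous_mult, of UNIV "\<lambda>z. (snd z, a0)"]
    by (simp add: case_prod_beta continuous_on_Pair continuous_on_fst continuous_on_snd)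
  ultimately have "(\<lambda>z. apply_bcontfun F (act (fst z) a0, snd z \<otimes> a0)) \<in> bcontfun"
    by (intro bcontfun_ultra_compose continuous_intros)
  then show ?thesis
    by (simp add: opU_def case_prod_beta' Bcontfun_inverse)
qed

lemma apply_opV:
  "apply_bcontfun (opV G a0 F) (x, a) = apply_bcontfun F (x, inv a0 \<otimes> a)"
proof -
  have "continuous_on UNIV (\<lambda>z::'t::topological_space \<times> 'g. inv a0 \<otimes> snd z)"
    using continuous_on_compose2[OF continuous_mult, of UNIV "\<lambda>z. (inv a0, snd z)"]
    by (simp add: case_prod_beta continuous_on_Pair continuous_on_fst continuous_on_snd)
  then have "(\<lambda>z. apply_bcontfun F (fst z, inv a0 \<otimes> snd z)) \<in> bcontfun"
    by (intro bcontfun_ultra_compose continuous_intros)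
  then show ?thesis
    by (simp add: opV_def case_prod_beta' Bcontfun_inverse)
qed

lemma apply_opM:
  "apply_bcontfun (opM G act \<phi> F) (x, a) =
     apply_bcontfun \<phi> (act x (inv a)) * apply_bcontfun F (x, a)"
proof -
  have "continuous_on UNIV (\<lambda>z::'s \<times> 'g. inv (snd z))"
    using continuous_on_compose2[OF continuous_inv continuous_on_snd[OF continuous_on_id]] by simp
  then have "continuous_on UNIV (\<lambda>z::'s \<times> 'g. act (fst z) (inv (snd z)))"
    using continuous_on_compose2[OF continuous_act, of UNIV "\<lambda>z. (fst z, inv (snd z))"]
    by (simp add: case_prod_beta continuous_on_Pair continuous_on_fst)
  then have "(\<lambda>z. apply_bcontfun \<phi> (act (fst z) (inv (snd z))) * apply_bcontfun F z) \<in> bcontfun"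
    by (intro bcontfun_ultra_mult bcontfun_ultra_compose apply_bcontfun)
  then show ?thesis
    by (simp add: opM_def case_prod_beta' Bcontfun_inverse)
qed

end

end

theory Submission
  imports Defs
begin

text \<open>
  Write \<open>I\<close> for the family of the \<open>U\<close> and \<open>L\<close>, \<open>J\<close> for that of the \<open>V\<close> and \<open>M\<close>, and \<open>R(I)\<close>, \<open>R(J)\<close> for the
  strongly closed algebras that they generate. The two families commute with each other and
  commutants are strongly closed algebras, so \<open>R(J)\<close> is contained in the commutant of \<open>I\<close>. The
  substance is the converse: every \<open>B\<close> commuting with \<open>I\<close> lies in the strong closure of the
  finite sums of operators \<open>M\<^sub>\<phi> V\<^sub>b\<close> (\<open>commutant_setI_approximation\<close>).

  The reason is that \<open>B\<close> is determined by its values at the points \<open>(y, 1)\<close>, because it commutes with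
  the translations \<open>U\<close>, and is linear over the functions of \<open>x\<close>, because it commutes with the
  multiplications \<open>L\<close>. On functions that are invariant under an open subgroup \<open>H\<close> in the group
  variable, \<open>B\<close> is therefore given by finitely many functions on \<open>S\<close>, the values at \<open>(y, 1)\<close> of the
  images of the indicators of the cosets of \<open>H\<close>; and a sum of operators \<open>M\<^sub>\<phi> V\<^sub>b\<close> over representatives \<open>b\<close>
  of the cosets has these values. Arbitrary finite families of functions are reached since, for an
  ultrametric absolute value, the \<open>\<delta>\<close>-almost-periods of a function form an open subgroup
  (\<open>uniform_continuity_subgroup\<close>).

  The homeomorphism \<open>(x, a) \<mapsto> (xa\<^sup>-\<^sup>1, a\<^sup>-\<^sup>1)\<close> exchanges \<open>I\<close> and \<open>J\<close>, which gives the other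
  equality. The bicommutant statement follows because the third commutant of a set is its first.
  For the factor property, an element of either center commutes with both families; for a free
  action the multiplications in \<open>I\<close> and \<open>J\<close> separate the points of the product space, so such an
  element is a multiplication operator, and invariance under the translations makes its multiplier
  constant (\<open>commutants_meet_in_scalars\<close>).
\<close>

section \<open>Operators on spaces of continuous functions\<close>

lemma sup_norm_eq_dist: "sup_norm F = dist F (const_bcontfun 0)"
  by (simp add: sup_norm_def dist_bcontfun_def vabs_dist_zero const_bcontfun.rep_eq)

lemma vabs_le_sup_norm: "vabs (apply_bcontfun F z) \<le> sup_norm F"
  using dist_bounded[of F z "const_bcontfun 0"]
  by (simp add: sup_norm_eq_dist const_bcontfun.rep_eq vabs_dist_zero)

lemma sup_norm_ge_zero: "0 \<le> sup_norm F"
  by (simp add: sup_norm_eq_dist)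

lemma sup_norm_le: "(\<And>z. vabs (apply_bcontfun F z) \<le> b) \<Longrightarrow> sup_norm F \<le> b"
  unfolding sup_norm_eq_dist
  by (intro dist_bound) (simp add: const_bcontfun.rep_eq vabs_dist_zero)

lemma dist_eq_sup_norm: "dist F H = sup_norm (cf_add F (cf_scale (- 1) H))"
  by (simp add: sup_norm_def dist_bcontfun_def dist_vabs apply_cf_add apply_cf_scale)

lemma bounded_operator_add: "bounded_operator T \<Longrightarrow> T (cf_add F H) = cf_add (T F) (T H)"
  by (simp add: bounded_operator_def)

lemma bounded_operator_scale: "bounded_operator T \<Longrightarrow> T (cf_scale c F) = cf_scale c (T F)"
  by (simp add: bounded_operator_def)

lemma bounded_operator_zero:
  assumes "bounded_operator T"
  shows "T (const_bcontfun 0) = const_bcontfun 0"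
proof -
  have zero: "cf_scale 0 F = const_bcontfun 0"
    for F :: "'x::topological_space \<Rightarrow>\<^sub>C 'k::ultrametric_field"
    by (intro bcontfun_eqI) (simp add: apply_cf_scale const_bcontfun.rep_eq)
  show ?thesis using bounded_operator_scale[OF assms, of 0] unfolding zero .
qed

lemma bounded_operator_lipschitz:
  assumes "bounded_operator T"
  obtains C where "C > 0" and "\<And>F H. dist (T F) (T H) \<le> C * dist F H"
proof -
  obtain C where C: "\<And>F. sup_norm (T F) \<le> C * sup_norm F"
    using assms by (auto simp: bounded_operator_def)
  have "dist (T F) (T H) \<le> max C 1 * dist F H" for F H
  proof -
    have "dist (T F) (T H) = sup_norm (T (cf_add F (cf_scale (- 1) H)))"
      by (simp add: dist_eq_sup_norm bounded_operator_add bounded_operator_scale assms)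
    also have "\<dots> \<le> C * sup_norm (cf_add F (cf_scale (- 1) H))" by (rule C)
    also have "\<dots> \<le> max C 1 * dist F H"
      unfolding dist_eq_sup_norm by (intro mult_right_mono sup_norm_ge_zero) simp
    finally show ?thesis .
  qed
  then show thesis by (intro that[of "max C 1"]) auto
qed

lemma bounded_operatorI:
  assumes "\<And>F H. T (cf_add F H) = cf_add (T F) (T H)"
    and "\<And>c F. T (cf_scale c F) = cf_scale c (T F)"
    and "\<And>F z. vabs (apply_bcontfun (T F) z) \<le> C * sup_norm F"
  shows "bounded_operator T"
  using assms sup_norm_le unfolding bounded_operator_def by blast

text \<open>
  The operators \<open>opU\<close>, \<open>opV\<close>, \<open>opL\<close>, \<open>opM\<close> are all of this form, for a homeomorphism \<open>h\<close>.
\<close>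
lemma bounded_operator_weighted_composition:
  assumes T: "\<And>F z. apply_bcontfun (T F) z = w z * apply_bcontfun F (h z)"
    and w: "\<And>z. vabs (w z) \<le> C"
  shows "bounded_operator T"
proof (rule bounded_operatorI)
  show "vabs (apply_bcontfun (T F) z) \<le> C * sup_norm F" for F z
    unfolding T vabs_mult using w vabs_ge_zero order_trans[OF vabs_ge_zero w]
    by (intro mult_mono vabs_le_sup_norm) auto
qed (auto intro!: bcontfun_eqI simp: T apply_cf_add apply_cf_scale algebra_simps)

lemma bounded_operator_op_zero: "bounded_operator op_zero"
  by (rule bounded_operator_weighted_composition[where w = "\<lambda>_. 0" and h = id and C = 0])
    (auto simp: op_zero_def const_bcontfun.rep_eq)

lemma bounded_operator_id: "bounded_operator id"
  by (rule bounded_operator_weighted_composition[where w = "\<lambda>_. 1" and h = id and C = 1])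
    (auto simp: vabs_one)

lemma bounded_operator_op_scale:
  assumes "bounded_operator A"
  shows "bounded_operator (op_scale c A)"
proof -
  obtain C where C: "\<And>F. sup_norm (A F) \<le> C * sup_norm F"
    using assms by (auto simp: bounded_operator_def)
  show ?thesis
  proof (rule bounded_operatorI)
    fix F z
    have "vabs (apply_bcontfun (A F) z) \<le> C * sup_norm F"
      using C vabs_le_sup_norm order_trans by blast
    then show "vabs (apply_bcontfun (op_scale c A F) z) \<le> (vabs c * C) * sup_norm F"
      by (simp add: op_scale_def apply_cf_scale vabs_mult mult.assoc mult_left_mono)
  qed (auto intro!: bcontfun_eqI simp: op_scale_def bounded_operator_add[OF assms]
      bounded_operator_scale[OF assms] apply_cf_add apply_cf_scale algebra_simps)
qed

lemma bounded_operator_op_add: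
  assumes "bounded_operator A" and "bounded_operator B"
  shows "bounded_operator (op_add A B)"
proof -
  obtain C D where C: "\<And>F. sup_norm (A F) \<le> C * sup_norm F"
    and D: "\<And>F. sup_norm (B F) \<le> D * sup_norm F"
    using assms by (auto simp: bounded_operator_def)
  show ?thesis
  proof (rule bounded_operatorI)
    fix F z
    have "vabs (apply_bcontfun (A F) z + apply_bcontfun (B F) z) \<le> C * sup_norm F + D * sup_norm F"
      using C[of F] D[of F] vabs_le_sup_norm[of "A F" z] vabs_le_sup_norm[of "B F" z]
        vabs_triangle[of "apply_bcontfun (A F) z" "apply_bcontfun (B F) z"] by linarith
    then show "vabs (apply_bcontfun (op_add A B F) z) \<le> (C + D) * sup_norm F"
      by (simp add: op_add_def apply_cf_add distrib_right)
  qed (auto intro!: bcontfun_eqI simp: op_add_def bounded_operator_add[OF assms(1)]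
      bounded_operator_scale[OF assms(1)] bounded_operator_add[OF assms(2)]
      bounded_operator_scale[OF assms(2)] apply_cf_add apply_cf_scale algebra_simps)
qed

lemma bounded_operator_comp:
  assumes A: "bounded_operator A" and B: "bounded_operator B"
  shows "bounded_operator (A \<circ> B)"
proof -
  obtain C D where C: "\<And>F. sup_norm (A F) \<le> C * sup_norm F"
    and D: "\<And>F. sup_norm (B F) \<le> D * sup_norm F"
    using assms by (auto simp: bounded_operator_def)
  have "sup_norm (A (B F)) \<le> (max C 0 * D) * sup_norm F" for F
  proof -
    have "sup_norm (A (B F)) \<le> max C 0 * sup_norm (B F)"
      by (rule order_trans[OF C]) (intro mult_right_mono sup_norm_ge_zero, simp)
    also have "\<dots> \<le> max C 0 * (D * sup_norm F)"
      by (intro mult_left_mono D) simp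
    finally show ?thesis by (simp add: mult.assoc)
  qed
  then show ?thesis
    unfolding bounded_operator_def
    by (auto simp: bounded_operator_add[OF A] bounded_operator_scale[OF A]
        bounded_operator_add[OF B] bounded_operator_scale[OF B])
qed

lemma bounded_operator_sum:
  assumes B: "bounded_operator B" and R: "finite R"
  obtains S where "\<And>z. apply_bcontfun S z = (\<Sum>b\<in>R. apply_bcontfun (f b) z)"
    and "\<And>z. apply_bcontfun (B S) z = (\<Sum>b\<in>R. apply_bcontfun (B (f b)) z)"
proof -
  have "\<exists>S. (\<forall>z. apply_bcontfun S z = (\<Sum>b\<in>R. apply_bcontfun (f b) z)) \<and>
      (\<forall>z. apply_bcontfun (B S) z = (\<Sum>b\<in>R. apply_bcontfun (B (f b)) z))"
    using R
  proof induction
    case empty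
    show ?case
      by (intro exI[of _ "const_bcontfun 0"])
        (simp add: bounded_operator_zero[OF B] const_bcontfun.rep_eq)
  next
    case (insert c R)
    then obtain S where "\<forall>z. apply_bcontfun S z = (\<Sum>b\<in>R. apply_bcontfun (f b) z)"
      "\<forall>z. apply_bcontfun (B S) z = (\<Sum>b\<in>R. apply_bcontfun (B (f b)) z)" by blast
    with insert.hyps show ?case
      by (intro exI[of _ "cf_add (f c) S"]) (simp add: apply_cf_add bounded_operator_add[OF B])
  qed
  with that show thesis by blast
qed


section \<open>Commutants and strongly closed algebras\<close>

lemma operator_algebra_commutant:
  assumes X: "\<And>A. A \<in> X \<Longrightarrow> bounded_operator A"
  shows "operator_algebra (commutant X)"
  unfolding operator_algebra_def
proof (intro conjI ballI allI)
  show "bounded_operator A" if "A \<in> commutant X" for A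
    using that by (simp add: commutant_def)
  show "op_zero \<in> commutant X"
    using bounded_operator_op_zero bounded_operator_zero[OF X]
    by (auto simp: commutant_def op_zero_def)
next
  fix A B assume A: "A \<in> commutant X" and B: "B \<in> commutant X"
  have *: "D (A F) = A (D F)" "D (B F) = B (D F)" if "D \<in> X" for D F
    using A B that by (auto simp: commutant_def fun_eq_iff)
  show "op_add A B \<in> commutant X"
    using A B * by (auto simp: commutant_def bounded_operator_op_add[unfolded op_add_def] op_add_def
        bounded_operator_add[OF X])
  show "A \<circ> B \<in> commutant X"
    using A B * by (auto simp: commutant_def bounded_operator_comp)
next
  fix c A assume A: "A \<in> commutant X"
  have *: "D (A F) = A (D F)" if "D \<in> X" for D F
    using A that by (auto simp: commutant_def fun_eq_iff)
  show "op_scale c A \<in> commutant X"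
    using A * by (auto simp: commutant_def bounded_operator_op_scale[unfolded op_scale_def] op_scale_def
        bounded_operator_scale[OF X])
qed

lemma op_products_subset_algebra:
  assumes "operator_algebra R" and "id \<in> R" and "X \<subseteq> R"
  shows "op_products X \<subseteq> R"
proof -
  have "foldr (\<circ>) As id \<in> R" if "set As \<subseteq> X" for As
    using that by (induction As) (use assms in \<open>auto simp: operator_algebra_def\<close>)
  then show ?thesis by (auto simp: op_products_def)
qed

lemma op_span_subset_algebra:
  assumes "operator_algebra R" and "X \<subseteq> R"
  shows "op_span X \<subseteq> R"
proof
  fix T assume "T \<in> op_span X"
  then show "T \<in> R"
    by induction (use assms in \<open>auto simp: operator_algebra_def\<close>)
qed

text \<open>
  For a fixed function \<open>F\<close> both \<open>B \<mapsto> A (B F)\<close> and \<open>B \<mapsto> B (A F)\<close> are continuous for pointwise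
  convergence, the former because \<open>A\<close> is Lipschitz; so a commutant is an intersection of equalizers.
\<close>
lemma closedin_commutant:
  assumes X: "\<And>A. A \<in> X \<Longrightarrow> bounded_operator A"
  shows "closedin op_strong_topology (commutant X)"
proof -
  have cont: "continuous_on UNIV A" if "A \<in> X" for A
  proof -
    from X[OF that] obtain C where "C > 0" "\<And>F H. dist (A F) (A H) \<le> C * dist F H"
      by (rule bounded_operator_lipschitz) blast
    then have "C-lipschitz_on UNIV A" by (intro lipschitz_onI) auto
    then show ?thesis by (rule lipschitz_on_continuous_on)
  qed
  have "closed {B. A (B F) = B (A F)}" if "A \<in> X" for A F
    by (intro closed_Collect_eq continuous_on_product_coordinates
        continuous_on_compose2[OF cont[OF that]]) auto
  then have "closed (\<Inter>A\<in>X. \<Inter>F. {B. A (B F) = B (A F)})"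
    by (intro closed_INT ballI) auto
  moreover have "commutant X = {B. bounded_operator B} \<inter> (\<Inter>A\<in>X. \<Inter>F. {B. A (B F) = B (A F)})"
    by (auto simp: commutant_def fun_eq_iff)
  ultimately show ?thesis
    unfolding op_strong_topology_def by (simp add: closedin_subtopology_Int_closed)
qed

lemma op_span_op_products_subset_commutant:
  assumes X: "\<And>A. A \<in> X \<Longrightarrow> bounded_operator A" and Y: "Y \<subseteq> commutant X"
  shows "op_span (op_products Y) \<subseteq> commutant X"
proof -
  have "id \<in> commutant X" by (simp add: commutant_def bounded_operator_id)
  with operator_algebra_commutant[OF X] Y show ?thesis
    by (intro op_span_subset_algebra op_products_subset_algebra)
qed

lemma generated_closed_algebra_subset_commutant:
  assumes "\<And>A. A \<in> X \<Longrightarrow> bounded_operator A" and "Y \<subseteq> commutant X"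
  shows "generated_closed_algebra Y \<subseteq> commutant X"
  unfolding generated_closed_algebra_def
  by (intro closure_of_minimal op_span_op_products_subset_commutant closedin_commutant assms)

text \<open>
  A basic neighbourhood in the strong operator topology constrains the values at finitely many
  functions only.
\<close>
lemma in_generated_closed_algebraI:
  assumes X: "\<And>A. A \<in> op_span (op_products X) \<Longrightarrow> bounded_operator A"
    and B: "bounded_operator B"
    and approx: "\<And>\<F> \<epsilon>. finite \<F> \<Longrightarrow> \<epsilon> > 0 \<Longrightarrow>
      \<exists>T\<in>op_span (op_products X). \<forall>F\<in>\<F>. dist (T F) (B F) < \<epsilon>"
  shows "B \<in> generated_closed_algebra X"
  unfolding generated_closed_algebra_def in_closure_of
proof (intro conjI allI impI)
  show "B \<in> topspace op_strong_topology"
    using B by (simp add: op_strong_topology_def)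
  fix U assume "B \<in> U \<and> openin op_strong_topology U"
  then obtain V where V: "open V" "U = V \<inter> {T. bounded_operator T}" "B \<in> V"
    by (auto simp: op_strong_topology_def openin_subtopology)
  obtain N where N: "B \<in> (\<Pi>\<^sub>E i\<in>UNIV. N i)" "\<And>i. open (N i)" "finite {i. N i \<noteq> UNIV}"
    "(\<Pi>\<^sub>E i\<in>UNIV. N i) \<subseteq> V"
    using product_topology_open_contains_basis[OF V(1)[unfolded open_fun_def] V(3)] by auto
  have "\<exists>\<epsilon>>0. \<forall>F\<in>\<F>. ball (B F) \<epsilon> \<subseteq> N F" if "finite \<F>" for \<F>
    using that
  proof induction
    case empty
    show ?case by (intro exI[of _ 1]) auto
  next
    case (insert F \<F>)
    then obtain \<epsilon> where e: "\<epsilon> > 0" "\<forall>F\<in>\<F>. ball (B F) \<epsilon> \<subseteq> N F" by blast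
    have "B F \<in> N F" using N(1) by auto
    then obtain \<delta> where d: "\<delta> > 0" "ball (B F) \<delta> \<subseteq> N F"
      using N(2) open_contains_ball by blast
    from e d show ?case
      by (intro exI[of _ "min \<epsilon> \<delta>"]) (fastforce simp: ball_min_Int)
  qed
  from this[OF N(3)] obtain \<epsilon> where e: "\<epsilon> > 0" "\<And>F. N F \<noteq> UNIV \<Longrightarrow> ball (B F) \<epsilon> \<subseteq> N F"
    by auto
  obtain T where T: "T \<in> op_span (op_products X)" "\<forall>F\<in>{i. N i \<noteq> UNIV}. dist (T F) (B F) < \<epsilon>"
    using approx[OF N(3) e(1)] by blast
  have "T F \<in> N F" for F
    using T(2) e(2)[of F] by (cases "N F = UNIV") (auto simp: dist_commute subset_iff)
  then have "T \<in> V" using N(4) by auto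
  with T(1) X V(2) show "\<exists>y. y \<in> op_span (op_products X) \<and> y \<in> U" by blast
qed

lemma commutant_antimono: "X \<subseteq> Y \<Longrightarrow> commutant Y \<subseteq> commutant X"
  by (auto simp: commutant_def)

lemma subset_commutant_commutant:
  assumes "\<And>A. A \<in> X \<Longrightarrow> bounded_operator A"
  shows "X \<subseteq> commutant (commutant X)"
  using assms by (fastforce simp: commutant_def)

lemma commutant_triple:
  assumes "\<And>A. A \<in> X \<Longrightarrow> bounded_operator A"
  shows "commutant (commutant (commutant X)) = commutant X"
proof
  show "commutant (commutant (commutant X)) \<subseteq> commutant X"
    by (intro commutant_antimono subset_commutant_commutant assms)
  show "commutant X \<subseteq> commutant (commutant (commutant X))"
    by (rule subset_commutant_commutant) (simp add: commutant_def)
qed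


section \<open>Clopen sets\<close>

definition clopen_indicator :: "'x::topological_space set \<Rightarrow> ('x \<Rightarrow>\<^sub>C 'k::ultrametric_field)" where
  "clopen_indicator W = Bcontfun (\<lambda>z. of_bool (z \<in> W))"

lemma apply_clopen_indicator:
  assumes "open W" and "closed W"
  shows "apply_bcontfun (clopen_indicator W :: 'x::topological_space \<Rightarrow>\<^sub>C 'k::ultrametric_field) z =
    of_bool (z \<in> W)"
proof -
  have "continuous_on UNIV (\<lambda>z. of_bool (z \<in> W) :: 'k)"
  proof (rule continuous_on_open_vimage[OF open_UNIV, THEN iffD2], intro allI impI)
    fix B :: "'k set"
    have "(\<lambda>z. of_bool (z \<in> W)) -` B \<inter> UNIV \<in> {{}, W, - W, UNIV}"
      by (cases "0 \<in> B"; cases "1 \<in> B") (auto simp: of_bool_def split: if_splits)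
    then show "open ((\<lambda>z. of_bool (z \<in> W)) -` B \<inter> UNIV)"
      using assms by auto
  qed
  then have "(\<lambda>z. of_bool (z \<in> W) :: 'k) \<in> bcontfun"
    by (rule bcontfun_ultraI[of _ 1]) (simp add: of_bool_def vabs_one)
  then show ?thesis
    by (simp add: clopen_indicator_def Bcontfun_inverse)
qed

text \<open>
  In a compact Hausdorff space the component of a point is the intersection of its clopen
  neighbourhoods.
\<close>
lemma clopen_separation:
  fixes x y :: "'s::t2_space"
  assumes "compact (UNIV :: 's set)" and td: "totally_disconnected TYPE('s)" and "x \<noteq> y"
  obtains W where "open W" and "closed W" and "x \<in> W" and "y \<notin> W"
proof -
  have "\<not> connected_component_of euclidean x y"
  proof
    assume "connected_component_of euclidean x y"
    then have "y \<in> connected_component_set UNIV x"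
      by (auto simp: connected_component_of_def connected_component_def)
    with td \<open>x \<noteq> y\<close> show False by (auto simp: totally_disconnected_def)
  qed
  moreover have "quasi_component_of euclidean x = connected_component_of euclidean x"
  proof -
    have "compact_space (euclidean :: 's topology)"
      using assms(1) by (simp add: compact_space_def)
    moreover have "Hausdorff_space (euclidean :: 's topology)"
      using hausdorff by (auto simp: Hausdorff_space_def disjnt_def)
    ultimately show ?thesis by (intro quasi_eq_connected_component_of) simp
  qed
  ultimately have "\<not> quasi_component_of euclidean x y" by simp
  then obtain T where "open T" "closed T" "(x \<in> T) \<noteq> (y \<in> T)"
    by (auto simp: quasi_component_of_def)
  then show thesis
    by (cases "x \<in> T") (auto intro: that[of T] that[of "- T"])
qed


section \<open>Open subgroups and their cosets\<close>

context topological_comm_group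
begin

lemma in_carrier [simp]: "a \<in> carrier G"
  by (simp add: carrier_UNIV)

lemma mult_inv_cancel [simp]: "a \<otimes> (inv a \<otimes> b) = b"
  and inv_mult_cancel [simp]: "inv a \<otimes> (a \<otimes> b) = b"
  by (simp_all flip: m_assoc)

lemma continuous_on_mult:
  "continuous_on A f \<Longrightarrow> continuous_on A g \<Longrightarrow> continuous_on A (\<lambda>z. f z \<otimes> g z)"
  using continuous_on_compose2[OF continuous_mult, of A "\<lambda>z. (f z, g z)"]
  by (simp add: continuous_on_Pair)

lemma open_left_coset:
  assumes "open H"
  shows "open {a. b \<otimes> a \<in> H}"
  using open_vimage[OF assms, of "\<lambda>a. b \<otimes> a"] continuous_on_mult[of UNIV "\<lambda>_. b" "\<lambda>a. a"]
  by (simp add: vimage_def continuous_on_const continuous_on_id)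

text \<open>
  The complement of a coset is a union of other cosets, and these are open.
\<close>
lemma closed_left_coset:
  assumes H: "subgroup H G" and "open H"
  shows "closed {a. b \<otimes> a \<in> H}"
proof -
  have "- {a. b \<otimes> a \<in> H} = (\<Union>c\<in>- {a. b \<otimes> a \<in> H}. {a. inv c \<otimes> a \<in> H})"
  proof (rule subset_antisym[rotated]; rule subsetI)
    fix a assume "a \<in> (\<Union>c\<in>- {a. b \<otimes> a \<in> H}. {a. inv c \<otimes> a \<in> H})"
    then obtain c where c: "b \<otimes> c \<notin> H" "inv c \<otimes> a \<in> H" by auto
    have "b \<otimes> c = (b \<otimes> a) \<otimes> inv (inv c \<otimes> a)"
      by (simp add: inv_mult_group m_assoc)
    with c show "a \<in> - {a. b \<otimes> a \<in> H}"
      using subgroup.m_closed[OF H] subgroup.m_inv_closed[OF H] by auto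
  next
    fix a assume a: "a \<in> - {a. b \<otimes> a \<in> H}"
    have "inv a \<otimes> a \<in> H" using H by (simp add: subgroup.one_closed)
    with a show "a \<in> (\<Union>c\<in>- {a. b \<otimes> a \<in> H}. {a. inv c \<otimes> a \<in> H})" by blast
  qed
  moreover have "open (\<Union>c\<in>- {a. b \<otimes> a \<in> H}. {a. inv c \<otimes> a \<in> H})"
    by (intro open_UN ballI open_left_coset assms)
  ultimately show ?thesis unfolding closed_def by simp
qed

lemma finite_coset_representatives:
  assumes comp: "compact (UNIV :: 'g set)" and H: "subgroup H G" and "open H"
  obtains R where "finite R" and "\<And>a. \<exists>!b. b \<in> R \<and> inv b \<otimes> a \<in> H"
proof -
  obtain D where D: "finite D" "UNIV \<subseteq> (\<Union>b\<in>D. {a. inv b \<otimes> a \<in> H})"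
  proof (rule compactE_image[OF comp, of UNIV "\<lambda>b. {a. inv b \<otimes> a \<in> H}"])
    show "UNIV \<subseteq> (\<Union>b. {a. inv b \<otimes> a \<in> H})"
    proof
      fix a show "a \<in> (\<Union>b. {a. inv b \<otimes> a \<in> H})"
        by (rule UN_I[of a]) (simp_all add: subgroup.one_closed[OF H])
    qed
  qed (auto intro: open_left_coset assms)
  define r where "r a = (SOME b. inv b \<otimes> a \<in> H)" for a
  have r: "inv (r a) \<otimes> a \<in> H" for a
    unfolding r_def by (rule someI[of _ a]) (simp add: H subgroup.one_closed)
  have same: "inv b \<otimes> c \<in> H" if "inv b \<otimes> a \<in> H" "inv c \<otimes> a \<in> H" for a b c
  proof -
    have "inv b \<otimes> c = (inv b \<otimes> a) \<otimes> inv (inv c \<otimes> a)"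
      by (simp add: inv_mult_group m_assoc)
    with that show ?thesis
      using subgroup.m_closed[OF H] subgroup.m_inv_closed[OF H] by simp
  qed
  have trans: "inv b \<otimes> c \<in> H" if "inv b \<otimes> a \<in> H" "inv a \<otimes> c \<in> H" for a b c
  proof -
    have "inv b \<otimes> c = (inv b \<otimes> a) \<otimes> (inv a \<otimes> c)"
      by (simp add: m_assoc)
    with that show ?thesis using subgroup.m_closed[OF H] by simp
  qed
  have sym: "inv b \<otimes> a \<in> H" if "inv a \<otimes> b \<in> H" for a b
    using same[of b b a] that H by (simp add: subgroup.one_closed)
  have r_eq: "r a = r b" if "inv a \<otimes> b \<in> H" for a b
    unfolding r_def using that sym trans by (metis (lifting))
  show thesis
  proof (rule that)
    show "finite (r ` D)" using D(1) by simp
    fix a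
    obtain b where b: "b \<in> D" "inv b \<otimes> a \<in> H" using D(2) by auto
    show "\<exists>!b. b \<in> r ` D \<and> inv b \<otimes> a \<in> H"
    proof (rule ex1I[of _ "r b"])
      show "r b \<in> r ` D \<and> inv (r b) \<otimes> a \<in> H"
        using b r[of b] trans by blast
      fix c assume "c \<in> r ` D \<and> inv c \<otimes> a \<in> H"
      then obtain d where d: "c = r d" "inv (r d) \<otimes> a \<in> H" by auto
      with r[of d] have "inv d \<otimes> a \<in> H" using sym trans by blast
      with b have "inv d \<otimes> b \<in> H" using sym trans by blast
      then show "c = r b" using d r_eq by simp
    qed
  qed
qed

text \<open>
  By the ultrametric inequality, the translations that move every function of \<open>\<F>\<close> by less than
  \<open>\<delta>\<close> are closed under multiplication: this is why a uniform modulus of continuity is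
  a subgroup here, and not just a neighbourhood of the unit. Openness is compactness of the space
  of all \<open>(x, a)\<close>, through the tube lemma.
\<close>
lemma uniform_continuity_subgroup:
  fixes \<F> :: "(('y::topological_space \<times> 'g) \<Rightarrow>\<^sub>C 'k::ultrametric_field) set"
  assumes "compact (UNIV :: 'y set)" and "compact (UNIV :: 'g set)"
    and fin: "finite \<F>" and d: "\<delta> > 0"
  defines "H \<equiv> {h. \<forall>F\<in>\<F>. \<forall>x a. dist (apply_bcontfun F (x, a \<otimes> h)) (apply_bcontfun F (x, a)) < \<delta>}"
  shows "subgroup H G" and "open H"
proof -
  show "subgroup H G"
  proof
    show "\<one> \<in> H" using d by (simp add: H_def)
    show "h \<otimes> k \<in> H" if "h \<in> H" "k \<in> H" for h k
      unfolding H_def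
    proof (intro CollectI ballI allI)
      fix F x a assume F: "F \<in> \<F>"
      let ?f = "\<lambda>a. apply_bcontfun F (x, a)"
      have "vabs (?f (a \<otimes> (h \<otimes> k)) - ?f a) =
          vabs ((?f (a \<otimes> h \<otimes> k) - ?f (a \<otimes> h)) + (?f (a \<otimes> h) - ?f a))"
        by (simp add: m_assoc)
      also have "\<dots> \<le> max (vabs (?f (a \<otimes> h \<otimes> k) - ?f (a \<otimes> h))) (vabs (?f (a \<otimes> h) - ?f a))"
        by (rule vabs_add)
      also have "\<dots> < \<delta>"
        using that F by (simp add: H_def dist_vabs)
      finally show "dist (?f (a \<otimes> (h \<otimes> k))) (?f a) < \<delta>" by (simp add: dist_vabs)
    qed
    show "inv h \<in> H" if h: "h \<in> H" for h
      unfolding H_def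
    proof (intro CollectI ballI allI)
      fix F x a assume F: "F \<in> \<F>"
      have "dist (apply_bcontfun F (x, a \<otimes> inv h \<otimes> h)) (apply_bcontfun F (x, a \<otimes> inv h)) < \<delta>"
        using h F unfolding H_def by blast
      then show "dist (apply_bcontfun F (x, a \<otimes> inv h)) (apply_bcontfun F (x, a)) < \<delta>"
        by (simp add: m_assoc dist_commute)
    qed
  qed (simp add: carrier_UNIV)
  have comp: "compact (UNIV :: ('y \<times> 'g) set)"
    using compact_Times[OF assms(1,2)] by simp
  define P where
    "P F = {h. \<forall>x a. dist (apply_bcontfun F (x, a \<otimes> h)) (apply_bcontfun F (x, a)) < \<delta>}"
    for F :: "('y \<times> 'g) \<Rightarrow>\<^sub>C 'k"
  have "open (P F)" for F :: "('y \<times> 'g) \<Rightarrow>\<^sub>C 'k"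
  proof (subst open_subopen, intro ballI)
    fix h assume h: "h \<in> P F"
    define f where "f = (\<lambda>w :: 'g \<times> 'y \<times> 'g.
      dist (apply_bcontfun F (fst (snd w), snd (snd w) \<otimes> fst w)) (apply_bcontfun F (snd w)))"
    have "continuous_on UNIV f"
      unfolding f_def
      by (intro continuous_intros continuous_on_mult
          continuous_on_compose2[OF continuous_on_apply_bcontfun[of UNIV F]]) auto
    then have "open (f -` {..<\<delta>})" by (rule open_vimage[OF open_lessThan])
    moreover have "{h} \<times> UNIV \<subseteq> f -` {..<\<delta>}"
      using h by (auto simp: f_def P_def)
    ultimately have "\<exists>X. h \<in> X \<and> open X \<and> X \<times> UNIV \<subseteq> f -` {..<\<delta>}"
      by (rule Elementary_Topology.tube_lemma[OF comp])
    then obtain X where X: "h \<in> X" "open X" "X \<times> UNIV \<subseteq> f -` {..<\<delta>}"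
      by (elim exE conjE)
    have "X \<subseteq> P F"
      unfolding P_def
    proof (intro subsetI CollectI allI)
      fix k x a assume "k \<in> X"
      then have "(k, (x, a)) \<in> f -` {..<\<delta>}" using X(3) by blast
      then show "dist (apply_bcontfun F (x, a \<otimes> k)) (apply_bcontfun F (x, a)) < \<delta>"
        by (simp add: f_def)
    qed
    with X show "\<exists>T. open T \<and> h \<in> T \<and> T \<subseteq> P F"
      by blast
  qed
  then have "open (\<Inter>F\<in>\<F>. P F)"
    using fin by (intro open_INT) auto
  moreover have "H = (\<Inter>F\<in>\<F>. P F)"
    by (auto simp: H_def P_def)
  ultimately show "open H" by simp
qed

end


section \<open>The generating operators\<close>

context continuous_right_action
begin

lemma act_inv_act [simp]: "act (act x a) (inv a) = x"
  and act_act_inv [simp]: "act (act x (inv a)) a = x"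
  by (simp_all flip: act_mult add: act_one)

lemma act_act_commute: "act (act x a) b = act (act x b) a"
  by (simp flip: act_mult add: m_comm)

lemma bounded_opU: "bounded_operator (opU G act a0 :: ('s \<times> 'g, 'k::ultrametric_field) operator)"
  by (rule bounded_operator_weighted_composition[where w = "\<lambda>_. 1" and C = 1
        and h = "\<lambda>(x, a). (act x a0, a \<otimes> a0)"])
    (auto simp: apply_opU vabs_one)

lemma bounded_opV: "bounded_operator (opV G a0 :: ('s \<times> 'g, 'k::ultrametric_field) operator)"
  by (rule bounded_operator_weighted_composition[where w = "\<lambda>_. 1" and C = 1
        and h = "\<lambda>(x, a). (x, inv a0 \<otimes> a)"])
    (auto simp: apply_opV vabs_one)

lemma bounded_opL: "bounded_operator (opL \<phi> :: ('s \<times> 'g, 'k::ultrametric_field) operator)"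
  by (rule bounded_operator_weighted_composition[where w = "\<lambda>(x, a). apply_bcontfun \<phi> x"
        and C = "sup_norm \<phi>" and h = id])
    (auto simp: apply_opL vabs_le_sup_norm)

lemma bounded_opM: "bounded_operator (opM G act \<phi> :: ('s \<times> 'g, 'k::ultrametric_field) operator)"
  by (rule bounded_operator_weighted_composition[where C = "sup_norm \<phi>" and h = id
        and w = "\<lambda>(x, a). apply_bcontfun \<phi> (act x (inv a))"])
    (auto simp: apply_opM vabs_le_sup_norm)

lemma bounded_setI:
  "A \<in> (setI G act :: ('s \<times> 'g, 'k::ultrametric_field) operator set) \<Longrightarrow>
    bounded_operator A"
  by (auto simp: setI_def bounded_opU bounded_opL)

lemma bounded_setJ:
  "A \<in> (setJ G act :: ('s \<times> 'g, 'k::ultrametric_field) operator set) \<Longrightarrow>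
    bounded_operator A"
  by (auto simp: setJ_def bounded_opV bounded_opM)

text \<open>
  For \<open>opU\<close> and \<open>opM\<close> this is the identity \<open>(xb)(ab)\<^sup>-\<^sup>1 = xa\<^sup>-\<^sup>1\<close>. Of the other pairs, \<open>opU\<close> and \<open>opV\<close>
  translate the group variable on different sides, \<open>opL\<close> and \<open>opV\<close> concern different variables, and
  \<open>opL\<close> and \<open>opM\<close> are both multiplications.
\<close>
lemma setI_setJ_commute:
  assumes "A \<in> (setI G act :: ('s \<times> 'g, 'k::ultrametric_field) operator set)" and "B \<in> setJ G act"
  shows "A \<circ> B = B \<circ> A"
proof (intro ext bcontfun_eqI)
  fix F :: "('s \<times> 'g) \<Rightarrow>\<^sub>C 'k" and z :: "'s \<times> 'g"
  obtain x a where z: "z = (x, a)" by (cases z)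
  have "act (act x b) (inv (a \<otimes> b)) = act x (inv a)" for b
    by (simp add: inv_mult flip: act_mult) (metis act_inv_act act_mult act_act_commute)
  with assms show "apply_bcontfun ((A \<circ> B) F) z = apply_bcontfun ((B \<circ> A) F) z"
    by (auto simp: setI_def setJ_def z apply_opU apply_opV apply_opL apply_opM m_assoc mult.left_commute)
qed

lemma setJ_subset_commutant_setI:
  "(setJ G act :: ('s \<times> 'g, 'k::ultrametric_field) operator set) \<subseteq> commutant (setI G act)"
  using setI_setJ_commute bounded_setJ by (auto simp: commutant_def)

lemma setI_subset_commutant_setJ:
  "(setI G act :: ('s \<times> 'g, 'k::ultrametric_field) operator set) \<subseteq> commutant (setJ G act)"
  using setI_setJ_commute[symmetric] bounded_setI by (auto simp: commutant_def)


section \<open>The involution exchanging the two families\<close>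

text \<open>
  Composition with the involution \<open>(x, a) \<mapsto> (xa\<^sup>-\<^sup>1, a\<^sup>-\<^sup>1)\<close> of the space. In these coordinates the
  roles of \<open>x\<close> and of \<open>xa\<^sup>-\<^sup>1\<close> are exchanged, hence so are \<open>opL\<close> and \<open>opM\<close>, and right translation
  becomes left translation. Conjugation by this operator therefore exchanges the two families and
  turns each result about one of them into the same result about the other.
\<close>
definition opW :: "('s \<times> 'g, 'k::ultrametric_field) operator" where
  "opW F = Bcontfun (\<lambda>(x, a). apply_bcontfun F (act x (inv a), inv a))"

lemma apply_opW: "apply_bcontfun (opW F) (x, a) = apply_bcontfun F (act x (inv a), inv a)"
proof -
  have inv: "continuous_on UNIV (\<lambda>z::'s \<times> 'g. inv (snd z))"
    using continuous_on_compose2[OF continuous_inv continuous_on_snd[OF continuous_on_id]] by simp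
  then have "continuous_on UNIV (\<lambda>z::'s \<times> 'g. act (fst z) (inv (snd z)))"
    using continuous_on_compose2[OF continuous_act, of UNIV "\<lambda>z. (fst z, inv (snd z))"]
    by (simp add: case_prod_beta continuous_on_Pair continuous_on_fst)
  with inv have "(\<lambda>z. apply_bcontfun F (act (fst z) (inv (snd z)), inv (snd z))) \<in> bcontfun"
    by (intro bcontfun_ultra_compose continuous_intros)
  then show ?thesis
    by (simp add: opW_def case_prod_beta' Bcontfun_inverse)
qed

lemma bounded_opW: "bounded_operator (opW :: ('s \<times> 'g, 'k::ultrametric_field) operator)"
  by (rule bounded_operator_weighted_composition[where w = "\<lambda>_. 1" and C = 1
        and h = "\<lambda>(x, a). (act x (inv a), inv a)"])
    (auto simp: apply_opW vabs_one)

lemma opW_involution: "opW \<circ> opW = (id :: ('s \<times> 'g, 'k::ultrametric_field) operator)"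
  by (intro ext bcontfun_eqI) (auto simp: apply_opW)

lemma opW_opW [simp]: "opW (opW F) = F"
  using opW_involution by (metis comp_apply id_apply)

lemma opW_opU: "opW \<circ> opU G act a0 \<circ> opW = opV G a0"
  by (intro ext bcontfun_eqI)
    (auto simp: apply_opW apply_opU apply_opV inv_mult m_comm simp flip: act_mult, 
     simp add: act_mult act_act_commute)

lemma opW_opL: "opW \<circ> opL \<phi> \<circ> opW = opM G act \<phi>"
  by (intro ext bcontfun_eqI) (auto simp: apply_opW apply_opL apply_opM)

lemma opW_conj_twice: "opW \<circ> (opW \<circ> A \<circ> opW) \<circ> opW = A"
  by (simp add: fun_eq_iff)

lemma opW_conj_setI:
  "(\<lambda>A. opW \<circ> A \<circ> opW) ` setI G act = (setJ G act :: ('s \<times> 'g, 'k::ultrametric_field) operator set)"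
proof -
  have "(\<lambda>A. opW \<circ> A \<circ> opW) ` setI G act =
    {opW \<circ> opU G act a0 \<circ> opW | a0. a0 \<in> carrier G} \<union> {opW \<circ> opL \<phi> \<circ> opW | \<phi>. True}"
    unfolding setI_def by blast
  then show ?thesis by (simp only: opW_opU opW_opL setJ_def)
qed

lemma opW_conj_setJ:
  "(\<lambda>A. opW \<circ> A \<circ> opW) ` setJ G act = (setI G act :: ('s \<times> 'g, 'k::ultrametric_field) operator set)"
  by (simp only: opW_conj_setI[symmetric] image_image opW_conj_twice image_ident)

lemma opW_conj_commutant_setJ:
  assumes "B \<in> commutant (setJ G act :: ('s \<times> 'g, 'k::ultrametric_field) operator set)"
  shows "opW \<circ> B \<circ> opW \<in> commutant (setI G act)"
proof -
  have "A \<circ> (opW \<circ> B \<circ> opW) = opW \<circ> B \<circ> opW \<circ> A" if A: "A \<in> setI G act" for A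
  proof -
    have "(opW \<circ> A \<circ> opW) \<circ> B = B \<circ> (opW \<circ> A \<circ> opW)"
      using assms A opW_conj_setI by (auto simp: commutant_def)
    then have "opW ((opW \<circ> A \<circ> opW \<circ> B) (opW F)) = opW ((B \<circ> (opW \<circ> A \<circ> opW)) (opW F))" for F
      by simp
    then show ?thesis by (simp add: fun_eq_iff)
  qed
  then show ?thesis
    using assms by (auto simp: commutant_def intro!: bounded_operator_comp bounded_opW)
qed

lemma opW_conj_op_span_products:
  assumes "T \<in> op_span (op_products (setJ G act :: ('s \<times> 'g, 'k::ultrametric_field) operator set))"
  shows "opW \<circ> T \<circ> opW \<in> op_span (op_products (setI G act))"
proof -
  have prod: "opW \<circ> A \<circ> opW \<in> op_products (setI G act)"
    if "A \<in> op_products (setJ G act :: ('s \<times> 'g, 'k) operator set)" for A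
  proof -
    from that obtain As where As: "A = foldr (\<circ>) As id" "set As \<subseteq> setJ G act"
      by (auto simp: op_products_def)
    have "opW \<circ> foldr (\<circ>) As id \<circ> opW = foldr (\<circ>) (map (\<lambda>A. opW \<circ> A \<circ> opW) As) id"
    proof (induction As)
      case (Cons A As)
      have "opW \<circ> foldr (\<circ>) (A # As) id \<circ> opW = (opW \<circ> A \<circ> opW) \<circ> (opW \<circ> foldr (\<circ>) As id \<circ> opW)"
        by (simp add: fun_eq_iff)
      also have "\<dots> = foldr (\<circ>) (map (\<lambda>A. opW \<circ> A \<circ> opW) (A # As)) id"
        unfolding Cons.IH by simp
      finally show ?case .
    qed (simp add: opW_involution)
    moreover have "set (map (\<lambda>A. opW \<circ> A \<circ> opW) As) \<subseteq> setI G act"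
      using As(2) opW_conj_setJ by auto
    ultimately show ?thesis unfolding op_products_def As(1) by blast
  qed
  show ?thesis
    using assms
  proof induction
    case span_zero
    have "opW \<circ> op_zero \<circ> opW = (op_zero :: ('s \<times> 'g, 'k) operator)"
      by (intro ext bcontfun_eqI) (auto simp: apply_opW op_zero_def const_bcontfun.rep_eq)
    then show ?case by (simp only: op_span.span_zero)
  next
    case (span_step A B c)
    have "opW \<circ> op_add (op_scale c A) B \<circ> opW = op_add (op_scale c (opW \<circ> A \<circ> opW)) (opW \<circ> B \<circ> opW)"
      by (simp add: fun_eq_iff op_add_def op_scale_def bounded_operator_add[OF bounded_opW]
          bounded_operator_scale[OF bounded_opW])
    with span_step prod show ?case by (metis op_span.span_step)
  qed
qed

lemma dist_opW_le: "dist (opW F) (opW H) \<le> dist F H"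
  by (intro dist_bound) (auto simp: apply_opW split_paired_all intro!: dist_bounded)

end


section \<open>The generated algebras as commutants\<close>

context continuous_right_action
begin

lemma sum_opM_opV_in_span:
  assumes "finite R"
  shows "\<exists>T\<in>op_span (op_products (setJ G act :: ('s \<times> 'g, 'k::ultrametric_field) operator set)).
    \<forall>F x a. apply_bcontfun (T F) (x, a) =
      (\<Sum>b\<in>R. apply_bcontfun (\<phi> b) (act x (inv a)) * apply_bcontfun F (x, inv b \<otimes> a))"
  using assms
proof induction
  case empty
  show ?case
    by (intro bexI[of _ op_zero] op_span.span_zero) (simp add: op_zero_def const_bcontfun.rep_eq)
next
  case (insert b R)
  then obtain T :: "('s \<times> 'g, 'k) operator"
    where T: "T \<in> op_span (op_products (setJ G act))" "\<And>F x a. apply_bcontfun (T F) (x, a) =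
      (\<Sum>b\<in>R. apply_bcontfun (\<phi> b) (act x (inv a)) * apply_bcontfun F (x, inv b \<otimes> a))"
    by blast
  have "foldr (\<circ>) [opM G act (\<phi> b), opV G b] id \<in> op_products (setJ G act)"
    unfolding op_products_def by (rule CollectI, intro exI conjI, rule refl) (auto simp: setJ_def)
  from op_span.span_step[OF this T(1), of 1] show ?case
    by (rule bexI[rotated]) (use insert.hyps in
      \<open>simp add: op_add_def op_scale_def apply_cf_add apply_cf_scale apply_opM apply_opV T(2)\<close>)
qed

text \<open>
  Let \<open>H\<close> be an open subgroup such that the functions of \<open>\<F>\<close> vary by less than \<open>\<delta>\<close> on its cosets,
  let \<open>R\<close> represent the cosets, and let \<open>e\<^sub>b\<close> be the indicator of \<open>b\<^sup>-\<^sup>1H\<close> in the group variable.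
  The approximant \<open>T\<close> is the sum over \<open>b \<in> R\<close> of \<open>V\<^sub>b\<close> followed by \<open>M\<close> for the function
  \<open>\<phi>\<^sub>b(y) = (B e\<^sub>b)(y, 1)\<close>. Since \<open>B\<close> commutes with the operators \<open>U\<close>, translation by \<open>a\<close> gives
  \<open>\<phi>\<^sub>b(xa\<^sup>-\<^sup>1) = (B e)(x, a)\<close>, where \<open>e\<close> is the indicator of \<open>b\<^sup>-\<^sup>1aH\<close>. So for each \<open>a\<close> the value of
  \<open>T F\<close> at \<open>(x, a)\<close> equals that of \<open>B S\<close>, where \<open>S\<close> is the step function that replaces \<open>F\<close> on each
  coset \<open>b\<^sup>-\<^sup>1aH\<close> by its values at \<open>b\<^sup>-\<^sup>1a\<close>; these values are functions of \<open>x\<close>, and \<open>B\<close> is linear over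
  such functions because it commutes with the operators \<open>L\<close>. The step function \<open>S\<close> depends on \<open>a\<close>,
  but it is within \<open>\<delta>\<close> of \<open>F\<close> for every \<open>a\<close>, and so \<open>T F\<close> is uniformly within \<open>C \<delta>\<close> of \<open>B F\<close>.
\<close>
lemma commutant_setI_approximation:
  fixes B :: "('s \<times> 'g, 'k::ultrametric_field) operator"
  assumes S: "compact (UNIV :: 's set)" and G: "compact (UNIV :: 'g set)"
    and B: "B \<in> commutant (setI G act)" and \<F>: "finite \<F>" and \<epsilon>: "\<epsilon> > 0"
  shows "\<exists>T\<in>op_span (op_products (setJ G act)). \<forall>F\<in>\<F>. dist (T F) (B F) < \<epsilon>"
proof -
  have bB: "bounded_operator B" using B by (simp add: commutant_def)
  have BU: "opU G act a (B F) = B (opU G act a F)" for a F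
    using B by (auto simp: commutant_def setI_def fun_eq_iff)
  have BL: "opL \<phi> (B F) = B (opL \<phi> F)" for \<phi> F
    using B by (auto simp: commutant_def setI_def fun_eq_iff)
  obtain C where C: "C > 0" "\<And>F H. dist (B F) (B H) \<le> C * dist F H"
    using bounded_operator_lipschitz[OF bB] by blast
  \<comment> \<open>The factor 2 turns the weak bound \<open>C * \<delta>\<close> into a strict one.\<close>
  define \<delta> where "\<delta> = \<epsilon> / (2 * C)"
  have \<delta>: "\<delta> > 0" using \<epsilon> C(1) by (simp add: \<delta>_def)
  define H where "H = {h. \<forall>F\<in>\<F>. \<forall>x a. dist (apply_bcontfun F (x, a \<otimes> h)) (apply_bcontfun F (x, a)) < \<delta>}"
  have H: "subgroup H G" "open H"
    using uniform_continuity_subgroup[OF S G \<F> \<delta>] unfolding H_def by auto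
  obtain R where R: "finite R" "\<And>a. \<exists>!b. b \<in> R \<and> inv b \<otimes> a \<in> H"
    using finite_coset_representatives[OF G H] by blast
  define e :: "'g \<Rightarrow> (('s \<times> 'g) \<Rightarrow>\<^sub>C 'k)" where "e b = clopen_indicator (UNIV \<times> {z. b \<otimes> z \<in> H})" for b
  have e: "apply_bcontfun (e b) (x, z) = of_bool (b \<otimes> z \<in> H)" for b x z
    unfolding e_def using H
    by (subst apply_clopen_indicator)
      (auto intro!: open_Times closed_Times open_left_coset closed_left_coset)
  define slice :: "'g \<Rightarrow> (('s \<times> 'g) \<Rightarrow>\<^sub>C 'k) \<Rightarrow> ('s \<Rightarrow>\<^sub>C 'k)"
    where "slice c F = Bcontfun (\<lambda>x. apply_bcontfun F (x, c))" for c F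
  have slice: "apply_bcontfun (slice c F) x = apply_bcontfun F (x, c)" for c F x
    unfolding slice_def
    by (subst Bcontfun_inverse) (auto intro!: bcontfun_ultra_compose continuous_intros)
  define \<phi> where "\<phi> b = slice \<one> (B (e b))" for b
  have \<phi>: "apply_bcontfun (\<phi> b) (act x (inv a)) = apply_bcontfun (B (e (b \<otimes> inv a))) (x, a)" for b x a
  proof -
    have "opU G act a (e (b \<otimes> inv a)) = e b"
      by (intro bcontfun_eqI) (auto simp: apply_opU e m_ac split_paired_all)
    then have "apply_bcontfun (\<phi> b) (act x (inv a)) =
        apply_bcontfun (opU G act a (B (e (b \<otimes> inv a)))) (act x (inv a), \<one>)"
      by (simp add: BU \<phi>_def slice)
    then show ?thesis by (simp add: apply_opU)
  qed
  obtain T where T: "T \<in> op_span (op_products (setJ G act))"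
    "\<And>F x a. apply_bcontfun (T F) (x, a) =
      (\<Sum>b\<in>R. apply_bcontfun (\<phi> b) (act x (inv a)) * apply_bcontfun F (x, inv b \<otimes> a))"
    using sum_opM_opV_in_span[OF R(1), of \<phi>] by blast
  have "dist (T F) (B F) < \<epsilon>" if F: "F \<in> \<F>" for F
  proof -
    have "dist (apply_bcontfun (T F) (x, a)) (apply_bcontfun (B F) (x, a)) \<le> C * \<delta>" for x a
    proof -
      \<comment> \<open>\<open>S\<close> is the step function of the cosets \<open>b\<^sup>-\<^sup>1aH\<close>, with representatives adapted to \<open>a\<close>.\<close>
      obtain S where
        S: "\<And>w. apply_bcontfun S w =
          (\<Sum>b\<in>R. apply_bcontfun (opL (slice (inv b \<otimes> a) F) (e (b \<otimes> inv a))) w)"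
        and BS: "\<And>w. apply_bcontfun (B S) w =
          (\<Sum>b\<in>R. apply_bcontfun (B (opL (slice (inv b \<otimes> a) F) (e (b \<otimes> inv a)))) w)"
        by (rule bounded_operator_sum[OF bB R(1),
              of "\<lambda>b. opL (slice (inv b \<otimes> a) F) (e (b \<otimes> inv a))"]) blast
      have "apply_bcontfun (B S) (x, a) = apply_bcontfun (T F) (x, a)"
        by (simp add: BS T(2) \<phi> apply_opL slice mult.commute flip: BL)
      moreover have "dist S F \<le> \<delta>"
      proof (rule dist_bound, clarify)
        fix y z
        \<comment> \<open>Only one summand can be nonzero at \<open>(y, z)\<close>: that of the coset containing \<open>z\<close>.\<close>
        obtain c where c: "c \<in> R" "inv c \<otimes> (a \<otimes> inv z) \<in> H"
          and uniq: "\<And>b. b \<in> R \<Longrightarrow> inv b \<otimes> (a \<otimes> inv z) \<in> H \<Longrightarrow> b = c"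
          using R(2)[of "a \<otimes> inv z"] by blast
        have inH: "b \<otimes> inv a \<otimes> z \<in> H \<longleftrightarrow> inv b \<otimes> (a \<otimes> inv z) \<in> H" for b
        proof -
          have "inv b \<otimes> (a \<otimes> inv z) = inv (b \<otimes> inv a \<otimes> z)"
            by (simp add: inv_mult m_ac)
          then show ?thesis
            using H(1) by (metis inv_inv in_carrier subgroup.m_inv_closed)
        qed
        have "apply_bcontfun (opL (slice (inv b \<otimes> a) F) (e (b \<otimes> inv a))) (y, z) =
            (if b = c then apply_bcontfun F (y, inv c \<otimes> a) else 0)" if "b \<in> R" for b
          using c(2) uniq[OF that] inH[of b] by (cases "b = c") (auto simp: apply_opL slice e)
        then have "apply_bcontfun S (y, z) =
            (\<Sum>b\<in>R. if b = c then apply_bcontfun F (y, inv c \<otimes> a) else 0)"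
          unfolding S by (rule sum.cong[OF refl])
        also have "\<dots> = apply_bcontfun F (y, inv c \<otimes> a)"
          using R(1) c(1) by simp
        also have "inv c \<otimes> a = z \<otimes> (inv c \<otimes> (a \<otimes> inv z))"
          by (simp add: m_comm[of z] m_assoc)
        finally have "dist (apply_bcontfun S (y, z)) (apply_bcontfun F (y, z)) < \<delta>"
          using c(2) F unfolding H_def by auto
        then show "dist (apply_bcontfun S (y, z)) (apply_bcontfun F (y, z)) \<le> \<delta>" by simp
      qed
      then have "dist (B S) (B F) \<le> C * \<delta>"
        using C by (meson mult_left_mono less_imp_le order_trans)
      ultimately show ?thesis
        using dist_bounded[of "B S" "(x, a)" "B F"] by simp
    qed
    then have "dist (T F) (B F) \<le> C * \<delta>"
      by (intro dist_bound) auto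
    also have "\<dots> < \<epsilon>" using C(1) \<epsilon> by (simp add: \<delta>_def)
    finally show ?thesis .
  qed
  with T(1) show ?thesis by blast
qed

theorem generated_closed_algebra_setJ:
  assumes S: "compact (UNIV :: 's set)" and G: "compact (UNIV :: 'g set)"
  shows "generated_closed_algebra (setJ G act :: ('s \<times> 'g, 'k::ultrametric_field) operator set) =
    commutant (setI G act)"
proof
  show "generated_closed_algebra (setJ G act :: ('s \<times> 'g, 'k) operator set) \<subseteq> commutant (setI G act)"
    by (intro generated_closed_algebra_subset_commutant bounded_setI setJ_subset_commutant_setI)
  show "commutant (setI G act) \<subseteq> generated_closed_algebra (setJ G act :: ('s \<times> 'g, 'k) operator set)"
  proof
    fix B :: "('s \<times> 'g, 'k) operator" assume B: "B \<in> commutant (setI G act)"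
    show "B \<in> generated_closed_algebra (setJ G act)"
    proof (rule in_generated_closed_algebraI)
      show "bounded_operator A" if "A \<in> op_span (op_products (setJ G act))"
        for A :: "('s \<times> 'g, 'k) operator"
        using that op_span_op_products_subset_commutant[OF bounded_setI setJ_subset_commutant_setI]
        by (auto simp: commutant_def)
      show "bounded_operator B" using B by (simp add: commutant_def)
    qed (rule commutant_setI_approximation[OF S G B])
  qed
qed

text \<open>
  The commutant of \<open>setJ\<close> is carried by conjugation into that of \<open>setI\<close>, approximated there, and
  carried back; the conjugating operator does not increase distances.
\<close>
theorem generated_closed_algebra_setI:
  assumes S: "compact (UNIV :: 's set)" and G: "compact (UNIV :: 'g set)"
  shows "generated_closed_algebra (setI G act :: ('s \<times> 'g, 'k::ultrametric_field) operator set) =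
    commutant (setJ G act)"
proof
  show "generated_closed_algebra (setI G act :: ('s \<times> 'g, 'k) operator set) \<subseteq> commutant (setJ G act)"
    by (intro generated_closed_algebra_subset_commutant bounded_setJ setI_subset_commutant_setJ)
  show "commutant (setJ G act) \<subseteq> generated_closed_algebra (setI G act :: ('s \<times> 'g, 'k) operator set)"
  proof
    fix B :: "('s \<times> 'g, 'k) operator" assume B: "B \<in> commutant (setJ G act)"
    show "B \<in> generated_closed_algebra (setI G act)"
    proof (rule in_generated_closed_algebraI)
      show "bounded_operator A" if "A \<in> op_span (op_products (setI G act))"
        for A :: "('s \<times> 'g, 'k) operator"
        using that op_span_op_products_subset_commutant[OF bounded_setJ setI_subset_commutant_setJ]
        by (auto simp: commutant_def)
      show "bounded_operator B" using B by (simp add: commutant_def)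
      fix \<F> :: "(('s \<times> 'g) \<Rightarrow>\<^sub>C 'k) set" and \<epsilon> :: real assume "finite \<F>" "\<epsilon> > 0"
      then obtain T where T: "T \<in> op_span (op_products (setJ G act))"
        "\<forall>F\<in>opW ` \<F>. dist (T F) ((opW \<circ> B \<circ> opW) F) < \<epsilon>"
        using commutant_setI_approximation[OF S G opW_conj_commutant_setJ[OF B], of "opW ` \<F>" \<epsilon>]
        by auto
      have "dist ((opW \<circ> T \<circ> opW) F) (B F) < \<epsilon>" if "F \<in> \<F>" for F
        using T(2) that dist_opW_le[of "T (opW F)" "opW (B F)"] by fastforce
      with opW_conj_op_span_products[OF T(1)]
      show "\<exists>T\<in>op_span (op_products (setI G act)). \<forall>F\<in>\<F>. dist (T F) (B F) < \<epsilon>" by blast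
    qed
  qed
qed

end


section \<open>Operators commuting with both families\<close>

definition cf_mult ::
  "('x::topological_space \<Rightarrow>\<^sub>C 'k::ultrametric_field) \<Rightarrow> ('x \<Rightarrow>\<^sub>C 'k) \<Rightarrow> ('x \<Rightarrow>\<^sub>C 'k)" where
  "cf_mult E F = Bcontfun (\<lambda>x. apply_bcontfun E x * apply_bcontfun F x)"

lemma apply_cf_mult: "apply_bcontfun (cf_mult E F) x = apply_bcontfun E x * apply_bcontfun F x"
  by (simp add: cf_mult_def Bcontfun_inverse bcontfun_ultra_mult apply_bcontfun)

text \<open>
  It suffices that \<open>B F\<close> vanishes wherever \<open>F\<close> does, since \<open>F\<close> may be changed by a constant. If
  \<open>F\<close> vanishes at \<open>z0\<close>, then the set where \<open>F\<close> is not small is compact and avoids \<open>z0\<close>, so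
  a finite product \<open>E\<close> of separating idempotents kills it while \<open>E = 1\<close> at \<open>z0\<close>. As \<open>B\<close> commutes
  with multiplication by \<open>E\<close>, the value of \<open>B F\<close> at \<open>z0\<close> is that of \<open>B (E F)\<close>, and \<open>E F\<close> is small
  everywhere.
\<close>
lemma local_operator_is_multiplication:
  fixes B :: "('x::topological_space, 'k::ultrametric_field) operator"
  assumes comp: "compact (UNIV :: 'x set)" and B: "bounded_operator B"
    and sep: "\<And>z z0. z \<noteq> z0 \<Longrightarrow> \<exists>E. range (apply_bcontfun E) \<subseteq> {0, 1} \<and>
      apply_bcontfun E z0 = 1 \<and> apply_bcontfun E z = 0 \<and> (\<forall>F. B (cf_mult E F) = cf_mult E (B F))"
  shows "apply_bcontfun (B F) z0 = apply_bcontfun F z0 * apply_bcontfun (B (const_bcontfun 1)) z0"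
proof -
  obtain C where C: "C > 0" "\<And>F H. dist (B F) (B H) \<le> C * dist F H"
    using bounded_operator_lipschitz[OF B] by blast
  define \<E> where "\<E> = {E. range (apply_bcontfun E) \<subseteq> {0, 1} \<and>
      apply_bcontfun E z0 = 1 \<and> (\<forall>F. B (cf_mult E F) = cf_mult E (B F))}"
  have vanish: "apply_bcontfun (B F) z0 = 0" if F0: "apply_bcontfun F z0 = 0" for F
  proof (rule ccontr)
    assume "apply_bcontfun (B F) z0 \<noteq> 0"
    then have pos: "vabs (apply_bcontfun (B F) z0) > 0"
      using vabs_ge_zero[of "apply_bcontfun (B F) z0"] vabs_eq_zero[of "apply_bcontfun (B F) z0"] by linarith
    \<comment> \<open>The value will be bounded by \<open>C * \<delta>\<close>, which is half of it.\<close>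
    define \<delta> where "\<delta> = vabs (apply_bcontfun (B F) z0) / (2 * C)"
    have \<delta>: "\<delta> > 0" using pos C(1) by (simp add: \<delta>_def)
    define K where "K = {z. \<delta> \<le> vabs (apply_bcontfun F z)}"
    have "closed K"
    proof -
      have "K = {z. \<delta> \<le> dist (apply_bcontfun F z) 0}" by (simp add: K_def vabs_dist_zero)
      then show ?thesis by (simp add: closed_Collect_le continuous_on_dist)
    qed
    then have K: "compact K" using compact_Int_closed[OF comp] by simp
    have "open {z. apply_bcontfun E z = 0}" if "E \<in> \<E>" for E
    proof -
      have "{z. apply_bcontfun E z = 0} = {z. dist (apply_bcontfun E z) 0 < 1}"
        using that by (force simp: \<E>_def vabs_dist_zero vabs_one image_subset_iff)
      then show ?thesis by (simp add: open_Collect_less continuous_on_dist)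
    qed
    moreover have "K \<subseteq> (\<Union>E\<in>\<E>. {z. apply_bcontfun E z = 0})"
    proof
      fix z assume "z \<in> K"
      then have "z \<noteq> z0" using F0 \<delta> by (auto simp: K_def)
      from sep[OF this] show "z \<in> (\<Union>E\<in>\<E>. {z. apply_bcontfun E z = 0})"
        by (auto simp: \<E>_def)
    qed
    ultimately obtain D where D: "D \<subseteq> \<E>" "finite D" "K \<subseteq> (\<Union>E\<in>D. {z. apply_bcontfun E z = 0})"
      by (rule compactE_image[OF K]) blast
    have "\<exists>E\<in>\<E>. \<forall>E'\<in>D. \<forall>z. apply_bcontfun E' z = 0 \<longrightarrow> apply_bcontfun E z = 0"
      using D(2,1)
    proof induction
      case empty
      have "cf_mult (const_bcontfun 1) F = F" for F :: "'x \<Rightarrow>\<^sub>C 'k"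
        by (intro bcontfun_eqI) (simp add: apply_cf_mult const_bcontfun.rep_eq)
      then show ?case
        by (intro bexI[of _ "const_bcontfun 1"]) (auto simp: \<E>_def const_bcontfun.rep_eq)
    next
      case (insert E' D)
      then obtain E where E: "E \<in> \<E>" "\<forall>E'\<in>D. \<forall>z. apply_bcontfun E' z = 0 \<longrightarrow> apply_bcontfun E z = 0"
        by auto
      have "cf_mult (cf_mult E' E) F = cf_mult E' (cf_mult E F)" for F :: "'x \<Rightarrow>\<^sub>C 'k"
        by (intro bcontfun_eqI) (simp add: apply_cf_mult)
      with E(1) insert.prems have "cf_mult E' E \<in> \<E>"
        by (fastforce simp: \<E>_def apply_cf_mult image_subset_iff)
      with E(2) show ?case
        by (intro bexI[of _ "cf_mult E' E"]) (auto simp: apply_cf_mult)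
    qed
    then obtain E where E: "E \<in> \<E>" "\<And>z. z \<in> K \<Longrightarrow> apply_bcontfun E z = 0"
      using D(3) by blast
    have "dist (cf_mult E F) (const_bcontfun 0) \<le> \<delta>"
    proof (rule dist_bound)
      fix z
      have "vabs (apply_bcontfun E z) \<le> 1"
        using E(1) range_subsetD[of "apply_bcontfun E" "{0, 1}" z] by (auto simp: \<E>_def vabs_one)
      then have "vabs (apply_bcontfun E z * apply_bcontfun F z) \<le> \<delta>"
        using E(2)[of z] \<delta> mult_left_le_one_le[of "vabs (apply_bcontfun F z)" "vabs (apply_bcontfun E z)"]
        by (cases "z \<in> K") (auto simp: K_def vabs_mult)
      then show "dist (apply_bcontfun (cf_mult E F) z) (apply_bcontfun (const_bcontfun 0) z) \<le> \<delta>"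
        by (simp add: apply_cf_mult const_bcontfun.rep_eq vabs_dist_zero)
    qed
    then have "C * dist (cf_mult E F) (const_bcontfun 0) \<le> C * \<delta>"
      using C(1) by (simp add: mult_left_mono)
    then have "dist (B (cf_mult E F)) (const_bcontfun 0) \<le> C * \<delta>"
      using C(2)[of "cf_mult E F" "const_bcontfun 0"] by (simp add: bounded_operator_zero[OF B])
    moreover have "apply_bcontfun (B (cf_mult E F)) z0 = apply_bcontfun (B F) z0"
      using E(1) by (simp add: \<E>_def apply_cf_mult)
    ultimately have "vabs (apply_bcontfun (B F) z0) \<le> C * \<delta>"
      using vabs_le_sup_norm[of "B (cf_mult E F)" z0] by (simp add: sup_norm_eq_dist)
    then show False using pos C(1) by (simp add: \<delta>_def)
  qed
  define F' where "F' = cf_add F (cf_scale (- apply_bcontfun F z0) (const_bcontfun 1))"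
  have "apply_bcontfun (B F') z0 = 0"
    by (rule vanish) (simp add: F'_def apply_cf_add apply_cf_scale const_bcontfun.rep_eq)
  then show ?thesis
    by (simp add: F'_def bounded_operator_add[OF B] bounded_operator_scale[OF B] apply_cf_add apply_cf_scale)
qed

text \<open>
  For a free action \<open>(x, a)\<close> is determined by \<open>x\<close> and \<open>xa\<^sup>-\<^sup>1\<close>, so indicators of clopen sets composed
  with these two maps separate points. Multiplications by them are operators \<open>L\<close> and \<open>M\<close>, and
  hence an operator commuting with both families is multiplication by \<open>g = B 1\<close>. Commutation with
  the operators \<open>V\<close> makes \<open>g\<close> independent of \<open>a\<close>, and commutation with the operators \<open>U\<close>, by
  transitivity, independent of \<open>x\<close>.
\<close>
lemma commutants_meet_in_scalars:
  fixes G :: "'g::topological_space monoid" and act :: "'s::t2_space \<Rightarrow> 'g \<Rightarrow> 's"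
    and B :: "('s \<times> 'g, 'k::ultrametric_field) operator"
  assumes action: "continuous_right_action G act"
    and S: "compact (UNIV :: 's set)" "totally_disconnected TYPE('s)"
    and G: "compact (UNIV :: 'g set)"
    and trans: "transitive_action act" and free: "free_action G act"
    and BI: "B \<in> commutant (setI G act)" and BJ: "B \<in> commutant (setJ G act)"
  shows "\<exists>c. B = op_scale c id"
proof -
  interpret continuous_right_action G act by (rule action)
  have B: "bounded_operator B" using BI by (simp add: commutant_def)
  have BU: "opU G act a (B F) = B (opU G act a F)" for a F
    using BI by (auto simp: commutant_def setI_def fun_eq_iff)
  have BV: "opV G a (B F) = B (opV G a F)" for a F
    using BJ by (auto simp: commutant_def setJ_def fun_eq_iff)
  have BL: "opL \<phi> (B F) = B (opL \<phi> F)" for \<phi> F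
    using BI by (auto simp: commutant_def setI_def fun_eq_iff)
  have BM: "opM G act \<phi> (B F) = B (opM G act \<phi> F)" for \<phi> F
    using BJ by (auto simp: commutant_def setJ_def fun_eq_iff)
  have free': "a = b" if "act x a = act x b" for x a b
  proof -
    have "act x (a \<otimes>\<^bsub>G\<^esub> inv\<^bsub>G\<^esub> b) = x" using that by (simp add: act_mult)
    then have "a \<otimes>\<^bsub>G\<^esub> inv\<^bsub>G\<^esub> b = \<one>\<^bsub>G\<^esub>" using free by (auto simp: free_action_def)
    then show ?thesis by (metis in_carrier inv_equality inv_inv)
  qed
  let ?g = "apply_bcontfun (B (const_bcontfun 1))"
  have loc: "apply_bcontfun (B F) z0 = apply_bcontfun F z0 * ?g z0" for F z0
  proof (rule local_operator_is_multiplication[OF _ B])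
    show "compact (UNIV :: ('s \<times> 'g) set)" using compact_Times[OF S(1) G] by simp
    fix z z0 :: "'s \<times> 'g" assume "z \<noteq> z0"
    obtain x a x0 a0 where z: "z = (x, a)" "z0 = (x0, a0)" by (cases z; cases z0)
    show "\<exists>E. range (apply_bcontfun E) \<subseteq> {0, 1} \<and> apply_bcontfun E z0 = 1 \<and>
        apply_bcontfun E z = 0 \<and> (\<forall>F. B (cf_mult E F) = cf_mult E (B F))"
    proof (cases "x = x0")
      case False
      then obtain W where W: "open W" "closed W" "x0 \<in> W" "x \<notin> W"
        using clopen_separation[OF S] by metis
      note ind = apply_clopen_indicator[OF W(1,2)]
      have "cf_mult (opL (clopen_indicator W) (const_bcontfun 1)) F = opL (clopen_indicator W) F"
        for F :: "('s \<times> 'g) \<Rightarrow>\<^sub>C 'k"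
        by (intro bcontfun_eqI) (auto simp: apply_cf_mult apply_opL const_bcontfun.rep_eq)
      with W show ?thesis
        by (intro exI[of _ "opL (clopen_indicator W) (const_bcontfun 1)"])
          (auto simp: z apply_opL ind const_bcontfun.rep_eq BL)
    next
      case True
      with \<open>z \<noteq> z0\<close> have "a \<noteq> a0" by (simp add: z)
      then have "act x (inv\<^bsub>G\<^esub> a) \<noteq> act x (inv\<^bsub>G\<^esub> a0)"
        using free'[of x "inv\<^bsub>G\<^esub> a" "inv\<^bsub>G\<^esub> a0"] by (metis in_carrier inv_inv)
      then obtain W where W: "open W" "closed W" "act x0 (inv\<^bsub>G\<^esub> a0) \<in> W" "act x (inv\<^bsub>G\<^esub> a) \<notin> W"
        using clopen_separation[OF S] True by metis
      note ind = apply_clopen_indicator[OF W(1,2)]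
      have "cf_mult (opM G act (clopen_indicator W) (const_bcontfun 1)) F = opM G act (clopen_indicator W) F"
        for F :: "('s \<times> 'g) \<Rightarrow>\<^sub>C 'k"
        by (intro bcontfun_eqI) (auto simp: apply_cf_mult apply_opM const_bcontfun.rep_eq)
      with W show ?thesis
        by (intro exI[of _ "opM G act (clopen_indicator W) (const_bcontfun 1)"])
          (auto simp: z apply_opM ind const_bcontfun.rep_eq BM)
    qed
  qed
  have U: "?g (act x b, a \<otimes>\<^bsub>G\<^esub> b) = ?g (x, a)" for x a b
  proof -
    have "opU G act b (const_bcontfun 1) = (const_bcontfun 1 :: ('s \<times> 'g) \<Rightarrow>\<^sub>C 'k)"
      by (intro bcontfun_eqI) (auto simp: apply_opU const_bcontfun.rep_eq)
    then show ?thesis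
      using BU[of b "const_bcontfun 1"] apply_opU[of b "B (const_bcontfun 1)" x a] by simp
  qed
  have V: "?g (x, inv\<^bsub>G\<^esub> b \<otimes>\<^bsub>G\<^esub> a) = ?g (x, a)" for x a b
  proof -
    have "opV G b (const_bcontfun 1) = (const_bcontfun 1 :: ('s \<times> 'g) \<Rightarrow>\<^sub>C 'k)"
      by (intro bcontfun_eqI) (auto simp: apply_opV const_bcontfun.rep_eq)
    then show ?thesis
      using BV[of b "const_bcontfun 1"] apply_opV[of b "B (const_bcontfun 1)" x a] by simp
  qed
  obtain x0 :: 's where True by simp
  have const: "?g (x, a) = ?g (x0, \<one>\<^bsub>G\<^esub>)" for x a
  proof -
    obtain b where "act x0 b = x" using trans by (auto simp: transitive_action_def)
    then show ?thesis using U[of x0 b "\<one>\<^bsub>G\<^esub>"] V[of x "inv\<^bsub>G\<^esub> b" "\<one>\<^bsub>G\<^esub>"] V[of x a a] V[of x b b] by simp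
  qed
  have "B = op_scale (?g (x0, \<one>\<^bsub>G\<^esub>)) id"
  proof (intro ext bcontfun_eqI)
    fix F z
    show "apply_bcontfun (B F) z = apply_bcontfun (op_scale (?g (x0, \<one>\<^bsub>G\<^esub>)) id F) z"
      using loc[of F z] const[of "fst z" "snd z"]
      by (simp add: op_scale_def apply_cf_scale mult.commute)
  qed
  then show ?thesis ..
qed

text \<open>
  The center of \<open>commutant X\<close> commutes with \<open>X\<close> by membership, and with any \<open>Y\<close> inside
  \<open>commutant X\<close> by centrality.
\<close>
lemma factor_commutant:
  fixes X :: "('x::topological_space, 'k::ultrametric_field) operator set"
  assumes X: "\<And>A. A \<in> X \<Longrightarrow> bounded_operator A" and Y: "Y \<subseteq> commutant X"
    and scalar: "\<And>B. B \<in> commutant X \<Longrightarrow> B \<in> commutant Y \<Longrightarrow> \<exists>c. B = op_scale c id"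
  shows "factor (commutant X)"
  unfolding factor_def
proof (intro conjI equalityI subsetI)
  show alg: "operator_algebra (commutant X)" by (rule operator_algebra_commutant[OF X])
  show "B \<in> {op_scale c id | c. True}" if "B \<in> op_center (commutant X)" for B
  proof -
    have BX: "B \<in> commutant X" and "\<And>A. A \<in> commutant X \<Longrightarrow> A \<circ> B = B \<circ> A"
      using that by (auto simp: op_center_def)
    with Y have "B \<in> commutant Y" by (auto simp: commutant_def[of Y] commutant_def[of X])
    with BX scalar show ?thesis by blast
  qed
  fix B :: "('x, 'k) operator" assume "B \<in> {op_scale c id | c. True}"
  then obtain c where c: "B = op_scale c id" by blast
  have "id \<in> commutant X" by (simp add: commutant_def bounded_operator_id)
  with alg have "B \<in> commutant X" by (simp add: c operator_algebra_def)
  moreover have "A \<circ> B = B \<circ> A" if "A \<in> commutant X" for A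
    using that by (auto simp: c commutant_def op_scale_def fun_eq_iff bounded_operator_scale)
  ultimately show "B \<in> op_center (commutant X)" by (simp add: op_center_def)
qed


section \<open>Commutants, bicommutants and factors\<close>

theorem theorem4p1:
  fixes p :: nat
    and G :: "'g::{t2_space, second_countable_topology} monoid"
    and act :: "'s::t2_space \<Rightarrow> 'g \<Rightarrow> 's"
    and I J :: "('s \<times> 'g, 'k::{ultrametric_field, complete_space}) operator set"
  assumes "prime p"
    and "is_Cp p TYPE('k)"
    and "compact (UNIV :: 's set)" and "totally_disconnected TYPE('s)"
    and "compact (UNIV :: 'g set)" and "totally_disconnected TYPE('g)"
    and "infinite (carrier G)"
    and "p_compatible p G"
    and "continuous_right_action G act" and "transitive_action act"
  defines "I \<equiv> setI G act" and "J \<equiv> setJ G act"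
  shows "(generated_closed_algebra J = commutant I \<and> generated_closed_algebra I = commutant J) \<and>
    (generated_closed_algebra J = commutant (commutant (generated_closed_algebra J)) \<and>
     generated_closed_algebra I = commutant (commutant (generated_closed_algebra I))) \<and>
    (free_action G act \<longrightarrow>
     factor (generated_closed_algebra I) \<and> factor (generated_closed_algebra J))"
proof -
  interpret continuous_right_action G act by fact
  have bI: "bounded_operator A" if "A \<in> I" for A
    using that unfolding I_def by (rule bounded_setI)
  have bJ: "bounded_operator A" if "A \<in> J" for A
    using that unfolding J_def by (rule bounded_setJ)
  have RJ: "generated_closed_algebra J = commutant I"
    unfolding I_def J_def by (rule generated_closed_algebra_setJ) fact+
  have RI: "generated_closed_algebra I = commutant J"
    unfolding I_def J_def by (rule generated_closed_algebra_setI) fact+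
  have IJ: "I \<subseteq> commutant J" and JI: "J \<subseteq> commutant I"
    unfolding I_def J_def by (rule setI_subset_commutant_setJ setJ_subset_commutant_setI)+
  have "factor (commutant J) \<and> factor (commutant I)" if free: "free_action G act"
  proof -
    have scalar: "\<exists>c. B = op_scale c id" if "B \<in> commutant I" "B \<in> commutant J" for B
      using commutants_meet_in_scalars[of G act B] that free assms(3-5,9,10)
      unfolding I_def J_def by blast
    show ?thesis
      by (intro conjI factor_commutant[OF bJ IJ] factor_commutant[OF bI JI]) (auto intro: scalar)
  qed
  then show ?thesis
    unfolding RI RJ by (simp add: commutant_triple[OF bI] commutant_triple[OF bJ])
qed

end
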